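(* Let $\psi_1\in\Phi$ be a viscosity subsolution and $\psi_2\in\Phi$ a viscosity supersolution of the Hamilton--Jacobi equation $$\partial_t^{ci}\varphi(t,w)+H\bigl(t,z,w(-\tau(t,z)),\nabla^{ci}\varphi(t,w)\bigr)=0,\qquad t<T,\ z=w(0).$$ If $\psi_1(T,\cdot)\le\psi_2(T,\cdot)$ on $\operatorname{Lip}([-\bar\tau,0];\mathbb R^n)$, then $\psi_1\le\psi_2$ on $\mathbb G$. In particular, if $\psi_1$ and $\psi_2$ are two viscosity solutions of this equation with the terminal condition $\varphi(T,w)=g(w(0),w)$, $w\in\operatorname{Lip}([-\bar\tau,0];\mathbb R^n)$, then $\psi_1=\psi_2$.
   Context: Setting. Let $t_0<T$, $I=[t_0,T]$, $n,m\ge 1$; $A\subset\mathbb R^m$ is nonempty, convex and compact. $\|\cdot\|$ is the Euclidean norm on $\mathbb R^n$; $\|\cdot\|_1,\|\cdot\|_\infty$ are the usual $L^1,L^\infty$ norms for functions on $[-\bar\tau,0]$ (with $\bar\tau$ introduced in (7) below). $\mathbb G:=I\times\operatorname{Lip}([-\bar\tau,0];\mathbb R^n)$. For $t_0\le t<s\le T$, $\mathcal A_{t,s}$ is the set of measurable functions $\alpha:(t,s)\to A$. For $R>0$: $P(R)=\{w\in\operatorname{Lip}([-\bar\tau,0];\mathbb R^n):\|w\|_\infty\le R\}$, $V(R)=\{w\in P(R):\|\dot w\|_\infty\le R\}$, $B_R=\{x\in\mathbb R^n:\|x\|\le R\}$. $\mathcal X=\{(z,w):w\in\operatorname{Lip}([-\bar\tau,0];\mathbb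 R^n),\ z=w(0)\}$ with norm $\|(z,w)\|_{\mathcal X}=\|z\|+\|w\|_1$. Standing assumptions. (1) $f:I\times\mathbb R^n\times\mathbb R^n\times A\to\mathbb R^n$ and $L:I\times\mathbb R^n\times\mathbb R^n\times A\to\mathbb R$ are continuous. (2) There is $\lambda_f>0$ with $\|f(t,z,y,a)-f(t,z',y',a)\|\le\lambda_f(\|z-z'\|+\|y-y'\|)$ for all arguments, and hence $\|f(t,z,y,a)\|\le C_f(1+\|z\|+\|y\|)$ for some fixed $C_f>0$. (3) For every $(t,z,y)$ the set $\{(f(t,z,y,a),\ell)\in\mathbb R^n\times\mathbb R:a\in A,\ \ell\ge L(t,z,y,a)\}$ is convex. (4) For every $R>0$ there is $\lambda_L(R)>0$ with $|L(t,z,y,a)-L(t,z',y',a)|\le\lambda_L(R)(\|z-z'\|+\|y-y'\|)$ for $t\in I$, $a\in A$, $z,y,z',y'\in B_R$. (5) There is $C_L>0$ with $|L(t,z,y,a)|\le C_L(1+\|z\|+\|y\|)$ for all arguments. (6) $g:\mathcal X\to\mathbb R$ and for every $R>0$ there is $\lambda_g(R)>0$ with $|g(z_1,w_1)-g(z_2,w_2)|\le\lambda_g(R)\|(z_1,w_1)-(z_2,w_2)\|_{\mathcal X}$ for all $(z_i,w_i)\in\mathcal X$ with $w_i\in P(R)$. (7) $\tau:I\times\mathbb R^n\to[0,\infty)$ is $C^1$ with supremum $\bar\tau<\infty$, and there is $\lambda_\tau>0$ with $|\tau(t,z)-\tau(t,y)|\le\lambda_\tau\|z-y\|$ for all $t\in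 I$, $z,y\in\mathbb R^n$. (8) (Monotone delay) For every $r>0$ there is $d(r)>0$ such that for every $t\in I$, $w\in P(r)$, $\alpha\in\mathcal A_{t,T}$, the unique Lipschitz solution $x:[t-\bar\tau,T]\to\mathbb R^n$ of $\dot x(s)=f(s,x(s),x(s-\tau(s,x(s))),\alpha(s))$ for a.e. $s\in(t,T)$, $x(t+\theta)=w(\theta)$ for $\theta\in[-\bar\tau,0]$, satisfies $1-\tau_t(s,x(s))-\tau_z(s,x(s))\cdot\dot x(s)\ge d(r)$ for a.e. $s\in[t,T]$. Hamiltonian. $H(t,z,y,p)=\min_{a\in A}\{f(t,z,y,a)\cdot p+L(t,z,y,a)\}$. Co-invariant derivatives (only used to write the equation formally). $\varphi:\mathbb G\to\mathbb R$ is co-invariantly differentiable at $(t,w)$ with derivatives $\partial^{ci}_t\varphi(t,w)\in\mathbb R$, $\nabla^{ci}\varphi(t,w)\in\mathbb R^n$ if for every Lipschitz $y:[t-\bar\tau,\infty)\to\mathbb R^n$ with $y(t+\theta)=w(\theta)$ on $[-\bar\tau,0]$ and $s\in(t,T]$, $\varphi(s,y_s)-\varphi(t,w)=\partial^{ci}_t\varphi(t,w)(s-t)+\nabla^{ci}\varphi(t,w)\cdot(y(s)-y(t))+o(s-t)$, where $y_s(\theta)=y(s+\theta)$ and $o(\cdot)$ may depend on $y$. Polygonal extension and projection. For $(t,w)\in\mathbb G$, $z=w(0)$, $s\in(t,T]$, $x\in\mathbb R^n$, let $v=v^{s,x}$ be: $v(\xi)=w(\xi-t)$ for $\xi\in[t-\bar\tau,t)$;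 $v(\xi)=z+\frac{x-z}{s-t}(\xi-t)$ for $\xi\in[t,s]$; $v(\xi)=x$ for $\xi>s$. For $\varphi:\mathbb G\to\mathbb R$, the projection with base point $(t,w)$ is $\bar\varphi(s,x)=\varphi(s,v_s)$ for $(s,x)\in(t,T]\times\mathbb R^n$, where $v_s(\theta)=v(s+\theta)$, and $\bar\varphi(t,z)=\varphi(t,w)$. Cone: $K(a,b,z,C)=\{(s,x)\in[a,b]\times\mathbb R^n:\|x-z\|\le C(s-a)\}$. Class $\Phi$: functionals $\varphi:\mathbb G\to\mathbb R$ such that for every $R>0$ there is $\lambda_\varphi(R)>0$ with $|\varphi(t_1,w_1)-\varphi(t_2,w_2)|\le\lambda_\varphi(R)(|t_1-t_2|+\|w_1(0)-w_2(0)\|+\|w_1-w_2\|_1)$ for all $t_i\in I$, $w_i\in V(R)$. Viscosity solutions. $\varphi\in\Phi$ is a viscosity supersolution if for any $(t,w)\in\mathbb G$ with $t<T$, $z=w(0)$, any $\phi\in C^1(\mathbb R\times\mathbb R^n)$, $C>C_f(1+2\|w\|_\infty)$ and $\delta>0$ (with $t+\delta\le T$): if $\bar\varphi(t,z)-\phi(t,z)\le\bar\varphi(s,x)-\phi(s,x)$ for all $(s,x)\in K(t,t+\delta,z,C)$ (projection with base point $(t,w)$), then $\partial_t\phi(t,z)+H(t,z,w(-\tau(t,z)),\nabla\phi(t,z))\le 0$. It is a viscosity subsolution if, with the same quantifiers, $\bar\varphi(t,z)-\phi(t,z)\ge\bar\varphi(s,x)-\phi(s,x)$ on $K(t,t+\delta,z,C)$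 implies $\partial_t\phi(t,z)+H(t,z,w(-\tau(t,z)),\nabla\phi(t,z))\ge0$. A viscosity solution of the equation with the terminal condition is a $\varphi$ that is both a sub- and a supersolution and satisfies the terminal condition. *)

theory Defs
  imports "HOL-Analysis.Analysis"
begin

text \<open>
  Functions on \<open>[-h, 0]\<close> are represented as total functions that are \<open>undefined\<close> outside the
  interval, so that functions agreeing on \<open>[-h, 0]\<close> are equal and a functional can only depend
  on the values there.  The length \<open>h\<close> of the history is the supremum of the delay.
\<close>

definition Lip :: "real \<Rightarrow> (real \<Rightarrow> real^'n) set" where
  "Lip h = {w \<in> extensional {-h..0}. \<exists>M. M-lipschitz_on {-h..0} w}"

definition history :: "real \<Rightarrow> (real \<Rightarrow> real^'n) \<Rightarrow> real \<Rightarrow> (real \<Rightarrow> real^'n)" where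
  "history h y s = restrict (\<lambda>\<theta>. y (s + \<theta>)) {-h..0}"

definition L1_norm :: "real \<Rightarrow> (real \<Rightarrow> real^'n) \<Rightarrow> real" where
  "L1_norm h w = integral {-h..0} (\<lambda>\<theta>. norm (w \<theta>))"

text \<open>
  Only used for continuous \<open>w\<close>.  If \<open>h > 0\<close> it is then the essential supremum; in the degenerate
  case \<open>h = 0\<close> it is \<open>norm (w 0)\<close>.
\<close>

definition sup_norm :: "real \<Rightarrow> (real \<Rightarrow> real^'n) \<Rightarrow> real" where
  "sup_norm h w = (SUP \<theta>\<in>{-h..0}. norm (w \<theta>))"

definition P_ball :: "real \<Rightarrow> real \<Rightarrow> (real \<Rightarrow> real^'n) set" where
  "P_ball h R = {w \<in> Lip h. sup_norm h w \<le> R}"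

text \<open>The condition on the derivative is the unfolded form of a bound on its essential supremum.\<close>

definition V_ball :: "real \<Rightarrow> real \<Rightarrow> (real \<Rightarrow> real^'n) set" where
  "V_ball h R = {w \<in> P_ball h R.
     AE \<theta> in lebesgue_on {-h..0}. norm (vector_derivative w (at \<theta>)) \<le> R}"

definition X_space :: "real \<Rightarrow> ((real^'n) \<times> (real \<Rightarrow> real^'n)) set" where
  "X_space h = {(z, w). w \<in> Lip h \<and> z = w 0}"

definition X_norm :: "real \<Rightarrow> (real^'n) \<times> (real \<Rightarrow> real^'n) \<Rightarrow> real" where
  "X_norm h = (\<lambda>(z, w). norm z + L1_norm h w)"

definition controls :: "(real^'m) set \<Rightarrow> real \<Rightarrow> real \<Rightarrow> (real \<Rightarrow> real^'m) set" where
  "controls A t s =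
     {\<alpha> \<in> borel_measurable (lebesgue_on {t<..<s}). \<forall>\<xi>\<in>{t<..<s}. \<alpha> \<xi> \<in> A}"

text \<open>
  \<open>u\<close> is \<open>C\<^sup>1\<close> on \<open>J \<times> \<real>\<^sup>n\<close> with time derivative \<open>ut\<close> and space gradient \<open>uz\<close>.  If \<open>J\<close> is a
  nondegenerate compact interval, the time derivative is one-sided at the end points.
\<close>

definition C1_with ::
  "real set \<Rightarrow> (real \<Rightarrow> real^'n \<Rightarrow> real) \<Rightarrow> (real \<Rightarrow> real^'n \<Rightarrow> real)
    \<Rightarrow> (real \<Rightarrow> real^'n \<Rightarrow> real^'n) \<Rightarrow> bool" where
  "C1_with J u ut uz \<longleftrightarrow>
     (\<forall>t\<in>J. \<forall>z. ((\<lambda>(s, x). u s x) has_derivative (\<lambda>(k, v). ut t z * k + uz t z \<bullet> v))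
        (at (t, z) within J \<times> UNIV)) \<and>
     continuous_on (J \<times> UNIV) (\<lambda>(t, z). ut t z) \<and>
     continuous_on (J \<times> UNIV) (\<lambda>(t, z). uz t z)"

definition delay_solution ::
  "real \<Rightarrow> real \<Rightarrow> (real \<Rightarrow> real^'n \<Rightarrow> real)
    \<Rightarrow> (real \<Rightarrow> real^'n \<Rightarrow> real^'n \<Rightarrow> real^'m \<Rightarrow> real^'n)
    \<Rightarrow> real \<Rightarrow> (real \<Rightarrow> real^'n) \<Rightarrow> (real \<Rightarrow> real^'m) \<Rightarrow> (real \<Rightarrow> real^'n) \<Rightarrow> bool" where
  "delay_solution T h \<tau> f t w \<alpha> x \<longleftrightarrow>
     (\<exists>M. M-lipschitz_on {t - h..T} x) \<and>
     (\<forall>\<theta>\<in>{-h..0}. x (t + \<theta>) = w \<theta>) \<and>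
     (AE s in lebesgue_on {t<..<T}.
        (x has_vector_derivative f s (x s) (x (s - \<tau> s (x s))) (\<alpha> s)) (at s))"

text \<open>For compact nonempty \<open>A\<close> and continuous data the infimum is a minimum.\<close>

definition Hamiltonian ::
  "(real^'m) set \<Rightarrow> (real \<Rightarrow> real^'n \<Rightarrow> real^'n \<Rightarrow> real^'m \<Rightarrow> real^'n)
    \<Rightarrow> (real \<Rightarrow> real^'n \<Rightarrow> real^'n \<Rightarrow> real^'m \<Rightarrow> real)
    \<Rightarrow> real \<Rightarrow> real^'n \<Rightarrow> real^'n \<Rightarrow> real^'n \<Rightarrow> real" where
  "Hamiltonian A f L t z y p = (INF a\<in>A. f t z y a \<bullet> p + L t z y a)"

definition polygonal ::
  "real \<Rightarrow> (real \<Rightarrow> real^'n) \<Rightarrow> real \<Rightarrow> real^'n \<Rightarrow> (real \<Rightarrow> real^'n)" where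
  "polygonal t w s x \<xi> =
     (if \<xi> < t then w (\<xi> - t)
      else if \<xi> \<le> s then w 0 + ((\<xi> - t) / (s - t)) *\<^sub>R (x - w 0)
      else x)"

text \<open>
  The projection with base point \<open>(t, w)\<close> is only meaningful at \<open>(t, w 0)\<close> and at \<open>(s, x)\<close> with
  \<open>s > t\<close>; the cones below, whose apex is \<open>(t, w 0)\<close>, contain no other points.
\<close>

definition projection ::
  "real \<Rightarrow> (real \<Rightarrow> (real \<Rightarrow> real^'n) \<Rightarrow> real) \<Rightarrow> real \<Rightarrow> (real \<Rightarrow> real^'n)
    \<Rightarrow> real \<Rightarrow> real^'n \<Rightarrow> real" where
  "projection h \<phi> t w s x =
     (if t < s then \<phi> s (history h (polygonal t w s x) s) else \<phi> t w)"

definition cone :: "real \<Rightarrow> real \<Rightarrow> real^'n \<Rightarrow> real \<Rightarrow> (real \<times> (real^'n)) set" where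
  "cone a b z C = {(s, x). s \<in> {a..b} \<and> norm (x - z) \<le> C * (s - a)}"

definition class_Phi ::
  "real \<Rightarrow> real \<Rightarrow> real \<Rightarrow> (real \<Rightarrow> (real \<Rightarrow> real^'n) \<Rightarrow> real) set" where
  "class_Phi t0 T h = {\<phi>. \<forall>R>0. \<exists>l>0.
     \<forall>t1\<in>{t0..T}. \<forall>t2\<in>{t0..T}. \<forall>w1\<in>V_ball h R. \<forall>w2\<in>V_ball h R.
       \<bar>\<phi> t1 w1 - \<phi> t2 w2\<bar>
         \<le> l * (\<bar>t1 - t2\<bar> + norm (w1 0 - w2 0) + L1_norm h (\<lambda>\<theta>. w1 \<theta> - w2 \<theta>))}"

text \<open>In the following definitions \<open>Cf\<close> is the linear growth constant of the dynamics.\<close>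

definition viscosity_supersolution ::
  "real \<Rightarrow> real \<Rightarrow> real \<Rightarrow> (real \<Rightarrow> real^'n \<Rightarrow> real) \<Rightarrow> real
    \<Rightarrow> (real \<Rightarrow> real^'n \<Rightarrow> real^'n \<Rightarrow> real^'n \<Rightarrow> real)
    \<Rightarrow> (real \<Rightarrow> (real \<Rightarrow> real^'n) \<Rightarrow> real) \<Rightarrow> bool" where
  "viscosity_supersolution t0 T h \<tau> Cf H \<phi> \<longleftrightarrow>
     \<phi> \<in> class_Phi t0 T h \<and>
     (\<forall>t\<in>{t0..<T}. \<forall>w\<in>Lip h. \<forall>u ut uz C \<delta>.
        C1_with UNIV u ut uz \<and> C > Cf * (1 + 2 * sup_norm h w) \<and> \<delta> > 0 \<and> t + \<delta> \<le> T \<and>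
        (\<forall>(s, x)\<in>cone t (t + \<delta>) (w 0) C.
           projection h \<phi> t w t (w 0) - u t (w 0) \<le> projection h \<phi> t w s x - u s x)
        \<longrightarrow> ut t (w 0) + H t (w 0) (w (- \<tau> t (w 0))) (uz t (w 0)) \<le> 0)"

definition viscosity_subsolution ::
  "real \<Rightarrow> real \<Rightarrow> real \<Rightarrow> (real \<Rightarrow> real^'n \<Rightarrow> real) \<Rightarrow> real
    \<Rightarrow> (real \<Rightarrow> real^'n \<Rightarrow> real^'n \<Rightarrow> real^'n \<Rightarrow> real)
    \<Rightarrow> (real \<Rightarrow> (real \<Rightarrow> real^'n) \<Rightarrow> real) \<Rightarrow> bool" where
  "viscosity_subsolution t0 T h \<tau> Cf H \<phi> \<longleftrightarrow>
     \<phi> \<in> class_Phi t0 T h \<and>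
     (\<forall>t\<in>{t0..<T}. \<forall>w\<in>Lip h. \<forall>u ut uz C \<delta>.
        C1_with UNIV u ut uz \<and> C > Cf * (1 + 2 * sup_norm h w) \<and> \<delta> > 0 \<and> t + \<delta> \<le> T \<and>
        (\<forall>(s, x)\<in>cone t (t + \<delta>) (w 0) C.
           projection h \<phi> t w t (w 0) - u t (w 0) \<ge> projection h \<phi> t w s x - u s x)
        \<longrightarrow> ut t (w 0) + H t (w 0) (w (- \<tau> t (w 0))) (uz t (w 0)) \<ge> 0)"

definition viscosity_solution ::
  "real \<Rightarrow> real \<Rightarrow> real \<Rightarrow> (real \<Rightarrow> real^'n \<Rightarrow> real) \<Rightarrow> real
    \<Rightarrow> (real \<Rightarrow> real^'n \<Rightarrow> real^'n \<Rightarrow> real^'n \<Rightarrow> real)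
    \<Rightarrow> ((real^'n) \<times> (real \<Rightarrow> real^'n) \<Rightarrow> real)
    \<Rightarrow> (real \<Rightarrow> (real \<Rightarrow> real^'n) \<Rightarrow> real) \<Rightarrow> bool" where
  "viscosity_solution t0 T h \<tau> Cf H g \<phi> \<longleftrightarrow>
     viscosity_subsolution t0 T h \<tau> Cf H \<phi> \<and>
     viscosity_supersolution t0 T h \<tau> Cf H \<phi> \<and>
     (\<forall>w\<in>Lip h. \<phi> T w = g (w 0, w))"

end

theory Submission
  imports Defs "HOL-Complex_Analysis.Great_Picard"
begin

text \<open>
  Doubling of variables on a compact set of paths.  Restricted to a short time interval
  \<open>[t, S]\<close>, the \<open>K\<close>-Lipschitz paths with the given history at time \<open>t\<close> form a compact set, and for
  \<open>S - t \<le> 1 / (4 Cf)\<close> the slope \<open>K\<close> can be chosen above the cone constants along all of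
  these paths, so that polygonal extensions inside the cone of slope \<open>K\<close> remain in the set.  One
  maximises \<open>\<psi>1(s, y\<^sub>s) - \<psi>2(s', y'\<^sub>s\<^sub>')\<close>, penalised by
  \<open>(\<bar>s - s'\<bar>\<^sup>2 + \<bar>y(s) - y'(s')\<bar>\<^sup>2 + \<integral>\<bar>y - y'\<bar>\<^sup>2) / \<epsilon>\<close> with the integral over \<open>[t, min s s']\<close>.
  The local Lipschitz continuity of \<open>\<psi>1\<close> makes every difference at the maximum \<open>O(\<epsilon>)\<close>.
  Hence the common test gradient \<open>2 (y(s) - y'(s')) / \<epsilon>\<close> stays bounded, the integral term
  contributes only \<open>O(\<epsilon>)\<close> to the time derivatives, and the delayed values converge to
  each other because \<open>L\<^sup>1\<close>-closeness of equi-Lipschitz paths is uniform closeness.  Uniform continuity of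
  the Hamiltonian on bounded sets then contradicts the sub- and supersolution inequalities.
\<close>

subsection \<open>Lipschitz paths and their histories\<close>

text \<open>
  Where \<open>f\<close> is not differentiable, \<open>vector_derivative\<close> is the junk value \<open>SOME v. False\<close>.  Including
  its norm in the bound makes Rademacher's theorem unnecessary for membership in \<open>V_ball\<close>.
\<close>

lemma norm_vector_derivative_lipschitz:
  fixes f :: "real \<Rightarrow> real^'n"
  assumes "K-lipschitz_on S f" and "x \<in> interior S"
  shows "norm (vector_derivative f (at x)) \<le> max K (norm (SOME v :: real^'n. False))"
proof (cases "\<exists>v. (f has_vector_derivative v) (at x)")
  case True
  then obtain v where v: "(f has_vector_derivative v) (at x)" by blast
  \<comment> \<open>A single increment \<open>k\<close>, small enough to stay in \<open>S\<close>,
    suffices: the difference quotient has norm at most \<open>K\<close> and lies within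
    \<open>e\<close> of \<open>v\<close>.\<close>
  have "norm v \<le> K + e" if "e > 0" for e
  proof -
    obtain d where "d > 0" and d: "\<And>y. norm (y - x) < d \<Longrightarrow>
        norm (f y - f x - (y - x) *\<^sub>R v) \<le> e * norm (y - x)"
      using v \<open>e > 0\<close> unfolding has_vector_derivative_def has_derivative_at_alt by blast
    obtain d' where "d' > 0" and d': "cball x d' \<subseteq> S"
      using assms(2) by (auto simp: mem_interior_cball)
    define k where "k = min (d/2) d'"
    have k: "0 < k" "k < d" "x + k \<in> S"
      using \<open>d > 0\<close> \<open>d' > 0\<close> d' by (auto simp: k_def dist_norm min_def)
    have xS: "x \<in> S" using assms(2) interior_subset by blast
    have "norm (f (x + k) - f x) \<le> K * k"
      using lipschitz_on_normD[OF assms(1) k(3) xS] k by simp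
    moreover have "norm (f (x + k) - f x - k *\<^sub>R v) \<le> e * k"
      using d[of "x + k"] k by simp
    moreover have "norm (k *\<^sub>R v) \<le> norm (f (x + k) - f x) + norm (f (x + k) - f x - k *\<^sub>R v)"
      using norm_triangle_ineq4[of "f (x + k) - f x" "f (x + k) - f x - k *\<^sub>R v"] by simp
    ultimately have "k * norm v \<le> k * (K + e)"
      using k by (simp add: algebra_simps)
    then show ?thesis using k by simp
  qed
  then have "norm v \<le> K" by (rule field_le_epsilon)
  then show ?thesis using vector_derivative_at[OF v] by simp
next
  case False
  then show ?thesis by (simp add: vector_derivative_def)
qed

lemma history_apply [simp]: "\<theta> \<in> {-h..0} \<Longrightarrow> history h y s \<theta> = y (s + \<theta>)"
  by (simp add: history_def)

lemma lipschitz_on_history: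
  assumes "K-lipschitz_on {s - h..s} y"
  shows "K-lipschitz_on {-h..0} (history h y s)"
proof -
  have "K-lipschitz_on {-h..0} (\<lambda>\<theta>. y (s + \<theta>))"
  proof (rule lipschitz_onI)
    fix a b assume "a \<in> {-h..0}" "b \<in> {-h..0}"
    then show "dist (y (s + a)) (y (s + b)) \<le> K * dist a b"
      using lipschitz_onD[OF assms, of "s + a" "s + b"] by (simp add: dist_norm)
  qed (rule lipschitz_on_nonneg[OF assms])
  then show ?thesis by (subst lipschitz_on_cong[of K K "{-h..0}" "{-h..0}"]) auto
qed

lemma history_in_Lip:
  assumes "K-lipschitz_on {s - h..s} y"
  shows "history h y s \<in> Lip h"
  using lipschitz_on_history[OF assms] by (auto simp: Lip_def history_def)

lemma sup_norm_history_le: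
  assumes "0 \<le> h" and "\<And>\<eta>. \<eta> \<in> {s - h..s} \<Longrightarrow> norm (y \<eta>) \<le> R"
  shows "sup_norm h (history h y s) \<le> R"
  unfolding sup_norm_def
  by (rule cSUP_least) (use assms in auto)

lemma history_in_V_ball:
  fixes y :: "real \<Rightarrow> real^'n"
  assumes "0 \<le> h" and lip: "K-lipschitz_on {s - h..s} y"
    and bound: "\<And>\<eta>. \<eta> \<in> {s - h..s} \<Longrightarrow> norm (y \<eta>) \<le> R"
    and "K \<le> R" and "norm (SOME v :: real^'n. False) \<le> R"
  shows "history h y s \<in> V_ball h R"
proof -
  have "norm (vector_derivative (history h y s) (at \<theta>)) \<le> R" if "\<theta> \<in> {-h<..<0}" for \<theta>
    using norm_vector_derivative_lipschitz[OF lipschitz_on_history[OF lip], of \<theta>] that assms(4,5)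
    by auto
  \<comment> \<open>At the end points the two-sided derivative sees values outside the interval,
    where a history is \<open>undefined\<close>; these two points form a null set.\<close>
  moreover have "AE \<theta> in lebesgue. \<theta> \<notin> {-h, 0}"
    by (rule AE_not_in) (simp flip: negligible_iff_null_sets)
  ultimately have "AE \<theta> in lebesgue_on {-h..0}. norm (vector_derivative (history h y s) (at \<theta>)) \<le> R"
    by (subst AE_restrict_space_iff) (auto elim!: eventually_rev_mp)
  then show ?thesis
    using history_in_Lip[OF lip] sup_norm_history_le[OF \<open>0 \<le> h\<close> bound] by (simp add: V_ball_def P_ball_def)
qed

text \<open>Values outside \<open>{t - h..S}\<close> are left free, so convergence of paths always
  means uniform convergence on that interval. The slope \<open>K\<close> is both the Lipschitz
  constant and, later, the opening of the cones.\<close>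

definition paths :: "real \<Rightarrow> real \<Rightarrow> real \<Rightarrow> real \<Rightarrow> (real \<Rightarrow> real^'n) \<Rightarrow> (real \<Rightarrow> real^'n) set" where
  "paths h K t S w = {y. K-lipschitz_on {t - h..S} y \<and> (\<forall>\<theta>\<in>{-h..0}. y (t + \<theta>) = w \<theta>)}"

text \<open>Squared L2 distance since the initial time. The square is essential: for paths
  \<open>O(\<epsilon>)\<close> apart, extending one of them raises this quantity at rate
  \<open>O(\<epsilon>^2)\<close>, which is still small after division by
  \<open>\<epsilon>\<close>.\<close>

definition energy :: "real \<Rightarrow> real \<Rightarrow> (real \<Rightarrow> real^'n) \<Rightarrow> (real \<Rightarrow> real^'n) \<Rightarrow> real" where
  "energy t \<sigma> y y' = integral {t..\<sigma>} (\<lambda>\<eta>. (norm (y \<eta> - y' \<eta>))\<^sup>2)"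

lemma paths_continuous_on: "y \<in> paths h K t S w \<Longrightarrow> continuous_on {t - h..S} y"
  by (auto simp: paths_def intro: lipschitz_on_continuous_on)

lemma paths_history:
  assumes "y \<in> paths h K t S w" "\<eta> \<in> {t - h..t}"
  shows "y \<eta> = w (\<eta> - t)"
proof -
  have "\<eta> - t \<in> {-h..0}" using assms(2) by auto
  then have "y (t + (\<eta> - t)) = w (\<eta> - t)"
    using assms(1) unfolding paths_def by blast
  then show ?thesis by simp
qed

lemma paths_lipschitz:
  assumes "y \<in> paths h K t S w" "a \<in> {t - h..S}" "b \<in> {t - h..S}"
  shows "norm (y a - y b) \<le> K * \<bar>a - b\<bar>"
  using lipschitz_on_normD[of K "{t - h..S}" y a b] assms by (auto simp: paths_def)

lemma paths_lipschitz_history: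
  assumes "y \<in> paths h K t S w" "s \<in> {t..S}"
  shows "K-lipschitz_on {s - h..s} y"
  using assms by (auto simp: paths_def elim: lipschitz_on_subset)

lemma paths_norm_le:
  assumes "y \<in> paths h K t S w" "0 \<le> h" "\<eta> \<in> {t - h..S}" and R: "\<forall>\<theta>\<in>{-h..0}. norm (w \<theta>) \<le> R"
    and "0 \<le> K" "t \<le> S"
  shows "norm (y \<eta>) \<le> R + K * (S - t)"
proof (cases "\<eta> \<le> t")
  case True
  then have "y \<eta> = w (\<eta> - t)"
    using assms(1,3) by (intro paths_history) auto
  then show ?thesis using bspec[OF R, of "\<eta> - t"] True assms(3,5,6) by (simp add: add_increasing2)
next
  case False
  have "y t = w 0" using paths_history[OF assms(1), of t] assms(2) by simp
  then have "norm (y t) \<le> R" using bspec[OF R, of 0] assms(2) by simp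
  moreover have "norm (y \<eta> - y t) \<le> K * \<bar>\<eta> - t\<bar>"
    using assms False by (intro paths_lipschitz) auto
  moreover have "K * \<bar>\<eta> - t\<bar> \<le> K * (S - t)"
    using False assms by (intro mult_left_mono) auto
  ultimately show ?thesis using norm_triangle_sub[of "y \<eta>" "y t"] by linarith
qed

text \<open>Shifting \<open>y'\<close> by \<open>s' - s\<close> costs at most
  \<open>K * (s' - s)\<close> pointwise over a window of length \<open>h\<close>. What remains is
  the difference at equal times, which vanishes before \<open>t\<close> because both paths continue
  the same \<open>w\<close>.\<close>

lemma L1_history_diff:
  assumes y: "y \<in> paths h K t S w" and y': "y' \<in> paths h K t S w"
    and "0 \<le> h" and s: "t \<le> s" "s \<le> s'" "s' \<le> S"
  shows "L1_norm h (\<lambda>\<theta>. history h y s \<theta> - history h y' s' \<theta>)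
    \<le> h * K * (s' - s) + integral {t..s} (\<lambda>\<eta>. norm (y \<eta> - y' \<eta>))"
proof -
  let ?d = "\<lambda>\<eta>. norm (y \<eta> - y' \<eta>)"
  have cd: "continuous_on {t - h..S} ?d"
    using y y' by (intro continuous_intros paths_continuous_on)
  then have int: "?d integrable_on {a..b}" if "t - h \<le> a" "b \<le> S" for a b
    using that by (intro integrable_continuous_real continuous_on_subset[OF cd]) auto
  have c: "continuous_on {-h..0} (\<lambda>\<theta>. y (s + \<theta>))" "continuous_on {-h..0} (\<lambda>\<theta>. y' (s' + \<theta>))"
    "continuous_on {-h..0} (\<lambda>\<theta>. y' (s + \<theta>))"
    using s by (auto intro!: continuous_on_compose2[OF paths_continuous_on[OF y]]
        continuous_on_compose2[OF paths_continuous_on[OF y']] continuous_intros)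
  have "L1_norm h (\<lambda>\<theta>. history h y s \<theta> - history h y' s' \<theta>)
      = integral {-h..0} (\<lambda>\<theta>. norm (y (s + \<theta>) - y' (s' + \<theta>)))"
    unfolding L1_norm_def by (rule integral_cong) simp
  also have "\<dots> \<le> integral {-h..0} (\<lambda>\<theta>. K * (s' - s) + ?d (s + \<theta>))"
  proof (rule integral_le)
    fix \<theta> assume \<theta>: "\<theta> \<in> {-h..0}"
    have "norm (y' (s + \<theta>) - y' (s' + \<theta>)) \<le> K * \<bar>(s + \<theta>) - (s' + \<theta>)\<bar>"
      using \<theta> s by (intro paths_lipschitz[OF y']) auto
    then show "norm (y (s + \<theta>) - y' (s' + \<theta>)) \<le> K * (s' - s) + ?d (s + \<theta>)"
      using s norm_triangle_ineq[of "y (s + \<theta>) - y' (s + \<theta>)" "y' (s + \<theta>) - y' (s' + \<theta>)"] by simp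
  qed (use c in \<open>auto intro!: integrable_continuous_real continuous_intros\<close>)
  also have "\<dots> = h * K * (s' - s) + integral {-h..0} (\<lambda>\<theta>. ?d (s + \<theta>))"
    using \<open>0 \<le> h\<close> c by (subst integral_add) (auto intro!: integrable_continuous_real continuous_intros)
  also have "integral {-h..0} (\<lambda>\<theta>. ?d (s + \<theta>)) = integral {s - h..s} ?d"
    using integral_shift_real_ivl[of "s - h" s s ?d] by (simp add: add.commute)
  \<comment> \<open>The window is enlarged back to \<open>t - h\<close>, so that it can be split at
    \<open>t\<close> whether or not \<open>s - h\<close> lies before \<open>t\<close>.\<close>
  also have "\<dots> \<le> integral {t - h..s} ?d"
    using s by (intro integral_subset_le int) auto
  also have "\<dots> = integral {t - h..t} ?d + integral {t..s} ?d"
    using Henstock_Kurzweil_Integration.integral_combine[where a = "t - h" and c = t and b = s and f = ?d] int[of "t - h" s] s \<open>0 \<le> h\<close> by simp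
  also have "integral {t - h..t} ?d = integral {t - h..t} (\<lambda>_. 0)"
    by (rule integral_cong) (simp add: paths_history[OF y] paths_history[OF y'])
  finally show ?thesis by simp
qed

text \<open>The constant of a functional in the class depends on a bound for the histories and their
  derivatives. All histories of the paths share such a bound, so one constant serves them
  all.\<close>

lemma Phi_paths_lipschitz:
  fixes w :: "real \<Rightarrow> real^'n"
  assumes Phi: "\<phi> \<in> class_Phi t0 T h" and "0 \<le> h" "0 \<le> K" "t0 \<le> t" "t \<le> S" "S \<le> T"
    and B: "\<forall>\<theta>\<in>{-h..0}. norm (w \<theta>) \<le> B"
  shows "\<exists>M>0. \<forall>y\<in>paths h K t S w. \<forall>y'\<in>paths h K t S w. \<forall>s\<in>{t..S}. \<forall>s'\<in>{t..S}. \<bar>\<phi> s (history h y s) - \<phi> s' (history h y' s')\<bar>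
        \<le> M * (\<bar>s - s'\<bar> + norm (y s - y' s') + integral {t..min s s'} (\<lambda>\<eta>. norm (y \<eta> - y' \<eta>)))"
proof -
  \<comment> \<open>\<open>R\<close> dominates the values of the paths, their slope and the default
    value of a missing \<open>vector_derivative\<close>; the 1 keeps it positive.\<close>
  define R where "R = max 1 (max (B + K * (S - t)) (max K (norm (SOME v :: real^'n. False))))"
  have "R > 0" by (simp add: R_def)
  then obtain l where "l > 0" and l: "\<And>t1 t2 w1 w2. t1 \<in> {t0..T} \<Longrightarrow> t2 \<in> {t0..T} \<Longrightarrow>
      w1 \<in> V_ball h R \<Longrightarrow> w2 \<in> V_ball h R \<Longrightarrow> \<bar>\<phi> t1 w1 - \<phi> t2 w2\<bar>
         \<le> l * (\<bar>t1 - t2\<bar> + norm (w1 0 - w2 0) + L1_norm h (\<lambda>\<theta>. w1 \<theta> - w2 \<theta>))"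
    using Phi unfolding class_Phi_def by (auto 0 3)
  have V: "history h y s \<in> V_ball h R" if "y \<in> paths h K t S w" "s \<in> {t..S}" for y s
  proof (rule history_in_V_ball)
    show "K-lipschitz_on {s - h..s} y" using that by (rule paths_lipschitz_history)
    show "norm (y \<eta>) \<le> R" if "\<eta> \<in> {s - h..s}" for \<eta>
    proof -
      have "norm (y \<eta>) \<le> B + K * (S - t)"
        by (rule paths_norm_le[OF \<open>y \<in> _\<close> \<open>0 \<le> h\<close> _ B]) (use that \<open>s \<in> _\<close> assms in auto)
      then show ?thesis by (simp add: R_def)
    qed
  qed (use \<open>0 \<le> h\<close> in \<open>auto simp: R_def\<close>)
  let ?D = "\<lambda>s s' y y'. \<bar>s - s'\<bar> + norm (y s - y' s') + integral {t..min s s'} (\<lambda>\<eta>. norm (y \<eta> - y' \<eta>))"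
  have le: "\<bar>\<phi> s (history h y s) - \<phi> s' (history h y' s')\<bar> \<le> l * (1 + h * K) * ?D s s' y y'"
    if y: "y \<in> paths h K t S w" "y' \<in> paths h K t S w" and s: "s \<in> {t..S}" "s' \<in> {t..S}" "s \<le> s'" for y y' s s'
  proof -
    have "\<bar>\<phi> s (history h y s) - \<phi> s' (history h y' s')\<bar>
      \<le> l * (\<bar>s - s'\<bar> + norm (history h y s 0 - history h y' s' 0)
          + L1_norm h (\<lambda>\<theta>. history h y s \<theta> - history h y' s' \<theta>))"
      using s assms by (intro l V y) auto
    also have "\<dots> \<le> l * (\<bar>s - s'\<bar> + norm (y s - y' s') +
        (h * K * (s' - s) + integral {t..s} (\<lambda>\<eta>. norm (y \<eta> - y' \<eta>))))"
      using L1_history_diff[OF y \<open>0 \<le> h\<close>, of s s'] s \<open>l > 0\<close> \<open>0 \<le> h\<close> by (intro mult_left_mono) auto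
    also have "\<dots> = l * (h * K * (s' - s) + ?D s s' y y')"
      using s by (simp add: algebra_simps)
    also have "\<dots> \<le> l * (h * K * ?D s s' y y' + ?D s s' y y')"
    proof -
      \<comment> \<open>A non-integrable function has integral 0, so both cases are
        nonnegative.\<close>
      have "0 \<le> integral {t..min s s'} (\<lambda>\<eta>. norm (y \<eta> - y' \<eta>))"
        by (cases "(\<lambda>\<eta>. norm (y \<eta> - y' \<eta>)) integrable_on {t..min s s'}")
          (simp_all add: integral_nonneg not_integrable_integral)
      then have "s' - s \<le> ?D s s' y y'" using s by simp
      then show ?thesis
        using \<open>l > 0\<close> \<open>0 \<le> h\<close> \<open>0 \<le> K\<close> by (intro mult_left_mono add_right_mono) auto
    qed
    finally show ?thesis by (simp add: algebra_simps)
  qed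
  show ?thesis
  proof (intro exI[of _ "l * (1 + h * K)"] conjI ballI)
    show "l * (1 + h * K) > 0" using \<open>l > 0\<close> \<open>0 \<le> h\<close> \<open>0 \<le> K\<close> by (simp add: add_pos_nonneg)
    show "\<bar>\<phi> s (history h y s) - \<phi> s' (history h y' s')\<bar> \<le> l * (1 + h * K) * ?D s s' y y'"
      if "y \<in> paths h K t S w" "y' \<in> paths h K t S w" "s \<in> {t..S}" "s' \<in> {t..S}" for y y' s s'
    proof (cases "s \<le> s'")
      case False
      then show ?thesis using le[of y' y s' s] that
        by (simp add: abs_minus_commute norm_minus_commute min.commute)
    qed (use that le in blast)
  qed
qed

subsection \<open>Compactness of the set of paths\<close>

text \<open>Arzela-Ascoli applies because the paths are equibounded and equi-Lipschitz; the
  Lipschitz bound and the prescribed history survive pointwise limits.\<close>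

lemma paths_convergent_subsequence:
  fixes Y :: "nat \<Rightarrow> real \<Rightarrow> real^'n" and w :: "real \<Rightarrow> real^'n"
  assumes Y: "\<And>n. Y n \<in> paths h K t S w" and "0 \<le> h" "0 \<le> K" "t \<le> S"
    and B: "\<forall>\<theta>\<in>{-h..0}. norm (w \<theta>) \<le> B"
  obtains y r where "y \<in> paths h K t S w" "strict_mono r"
    "uniform_limit {t - h..S} (\<lambda>n. Y (r n)) y sequentially"
proof -
  obtain y r where r: "strict_mono (r :: nat \<Rightarrow> nat)"
    and u: "\<And>e. 0 < e \<Longrightarrow> \<exists>N. \<forall>n x. n \<ge> N \<and> x \<in> {t - h..S} \<longrightarrow> norm (Y (r n) x - y x) < e"
  proof (rule Arzela_Ascoli[of "{t - h..S}" Y "B + K * (S - t)"])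
    show "norm (Y n x) \<le> B + K * (S - t)" if "x \<in> {t - h..S}" for n x
      using paths_norm_le[OF Y \<open>0 \<le> h\<close> that B] \<open>0 \<le> K\<close> \<open>t \<le> S\<close> by blast
    show "\<exists>d>0. \<forall>n y. y \<in> {t - h..S} \<and> norm (x - y) < d \<longrightarrow> norm (Y n x - Y n y) < e"
      if x: "x \<in> {t - h..S}" and "0 < e" for x e
    \<comment> \<open>\<open>K + 1\<close> instead of \<open>K\<close>, since \<open>K\<close> may
      be 0.\<close>
    proof (intro exI[of _ "e / (K + 1)"] conjI allI impI)
      fix n y assume y: "y \<in> {t - h..S} \<and> norm (x - y) < e / (K + 1)"
      have "norm (Y n x - Y n y) \<le> K * \<bar>x - y\<bar>" using x y by (intro paths_lipschitz[OF Y]) auto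
      also have "\<dots> \<le> (K + 1) * \<bar>x - y\<bar>" by (simp add: algebra_simps)
      also have "\<dots> < e" using y \<open>0 \<le> K\<close> by (simp add: field_simps)
      finally show "norm (Y n x - Y n y) < e" .
    qed (use \<open>0 < e\<close> \<open>0 \<le> K\<close> in simp)
  qed auto
  have ul: "uniform_limit {t - h..S} (\<lambda>n. Y (r n)) y sequentially"
    unfolding uniform_limit_sequentially_iff dist_norm using u by meson
  then have lim: "(\<lambda>n. Y (r n) x) \<longlonglongrightarrow> y x" if "x \<in> {t - h..S}" for x
    using that by (rule tendsto_uniform_limitI)
  have "K-lipschitz_on {t - h..S} y"
  proof (rule lipschitz_onI)
    fix a b assume ab: "a \<in> {t - h..S}" "b \<in> {t - h..S}"
    have "(\<lambda>n. norm (Y (r n) a - Y (r n) b)) \<longlonglongrightarrow> norm (y a - y b)"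
      by (intro tendsto_intros lim ab)
    then have "norm (y a - y b) \<le> K * \<bar>a - b\<bar>"
      by (rule LIMSEQ_le_const2) (use paths_lipschitz[OF Y ab] in blast)
    then show "dist (y a) (y b) \<le> K * dist a b" by (simp add: dist_norm)
  qed fact
  moreover have "y (t + \<theta>) = w \<theta>" if "\<theta> \<in> {-h..0}" for \<theta>
  proof -
    have "Y (r n) (t + \<theta>) = w \<theta>" for n using Y that by (auto simp: paths_def)
    then show ?thesis
      using lim[of "t + \<theta>"] that \<open>t \<le> S\<close> by (simp add: LIMSEQ_const_iff)
  qed
  ultimately show thesis
    using that[OF _ r ul] by (auto simp: paths_def)
qed

text \<open>Integrand and upper limit vary together. Replacing \<open>f n\<close> by
  \<open>g\<close> costs the uniform error times the length; after that the indefinite integral of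
  the continuous \<open>g\<close> is continuous.\<close>

lemma tendsto_integral_uniform_limit:
  fixes f :: "nat \<Rightarrow> real \<Rightarrow> real"
  assumes u: "uniform_limit {a..b} f g sequentially" and f: "\<And>n. continuous_on {a..b} (f n)"
    and \<sigma>: "\<And>n. \<sigma> n \<in> {a..b}" "\<sigma> \<longlonglongrightarrow> c"
  shows "(\<lambda>n. integral {a..\<sigma> n} (f n)) \<longlonglongrightarrow> integral {a..c} g"
proof -
  have "closed {a..b}" by simp
  then have c: "c \<in> {a..b}" using \<sigma> by (metis closed_sequentially)
  have g: "continuous_on {a..b} g" by (rule uniform_limit_theorem[OF _ u]) (use f in auto)
  have sub: "{a..\<sigma> n} \<subseteq> {a..b}" for n using \<sigma>(1)[of n] by auto
  have "continuous_on {a..b} (\<lambda>x. integral {a..x} g)"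
    by (intro indefinite_integral_continuous_1 integrable_continuous_real g)
  then have 1: "(\<lambda>n. integral {a..\<sigma> n} g) \<longlonglongrightarrow> integral {a..c} g"
    by (rule continuous_on_tendsto_compose) (use \<sigma> c in auto)
  have 2: "(\<lambda>n. integral {a..\<sigma> n} (f n) - integral {a..\<sigma> n} g) \<longlonglongrightarrow> 0"
  proof (rule tendstoI)
    fix e :: real assume "e > 0"
    then have "e / (b - a + 1) > 0" using c by simp
    then have "\<forall>\<^sub>F n in sequentially. \<forall>x\<in>{a..b}. dist (f n x) (g x) < e / (b - a + 1)"
      by (rule uniform_limitD[OF u])
    then show "\<forall>\<^sub>F n in sequentially. dist (integral {a..\<sigma> n} (f n) - integral {a..\<sigma> n} g) 0 < e"
    proof eventually_elim
      case (elim n)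
      have "integral {a..\<sigma> n} (f n) - integral {a..\<sigma> n} g = integral {a..\<sigma> n} (\<lambda>x. f n x - g x)"
        by (intro integral_diff[symmetric] integrable_continuous_real continuous_on_subset[OF f sub]
            continuous_on_subset[OF g sub])
      also have "norm \<dots> \<le> e / (b - a + 1) * (\<sigma> n - a)"
        using \<sigma>(1)[of n] elim sub[of n]
        by (intro integral_bound continuous_intros continuous_on_subset[OF f sub]
            continuous_on_subset[OF g sub]) (auto simp: dist_norm intro: less_imp_le)
      also have "\<dots> \<le> e / (b - a + 1) * (b - a)"
        using \<sigma>(1)[of n] \<open>e / (b - a + 1) > 0\<close> by (intro mult_left_mono) auto
      also have "\<dots> < e" using \<open>e > 0\<close> c by (simp add: field_simps)
      finally show ?case by (simp add: dist_norm)
    qed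
  qed
  from tendsto_add[OF 2 1] show ?thesis by simp
qed

lemma uniform_limit_paths_diff:
  fixes y :: "real \<Rightarrow> real^'n"
  assumes "uniform_limit {t - h..S} Y y sequentially" "uniform_limit {t - h..S} Y' y' sequentially" "0 \<le> h"
  shows "uniform_limit {t..S} (\<lambda>n \<eta>. norm (Y n \<eta> - Y' n \<eta>)) (\<lambda>\<eta>. norm (y \<eta> - y' \<eta>)) sequentially"
proof (rule uniform_limit_on_subset)
  show "uniform_limit {t - h..S} (\<lambda>n \<eta>. norm (Y n \<eta> - Y' n \<eta>)) (\<lambda>\<eta>. norm (y \<eta> - y' \<eta>)) sequentially"
    by (intro uniform_limit_norm uniform_limit_minus assms(1,2))
qed (use assms(3) in auto)

lemma energy_tendsto:
  fixes w :: "real \<Rightarrow> real^'n"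
  assumes Y: "\<And>n. Y n \<in> paths h K t S w" "\<And>n. Y' n \<in> paths h K t S w"
    and y: "y \<in> paths h K t S w" "y' \<in> paths h K t S w" and "0 \<le> h"
    and u: "uniform_limit {t - h..S} Y y sequentially" "uniform_limit {t - h..S} Y' y' sequentially"
    and \<sigma>: "\<And>n. \<sigma> n \<in> {t..S}" "\<sigma> \<longlonglongrightarrow> c"
  shows "(\<lambda>n. energy t (\<sigma> n) (Y n) (Y' n)) \<longlonglongrightarrow> energy t c y y'"
  unfolding energy_def
proof (rule tendsto_integral_uniform_limit[OF _ _ \<sigma>])
  have c: "continuous_on {t..S} (\<lambda>\<eta>. norm (y \<eta> - y' \<eta>))" if "y \<in> paths h K t S w" "y' \<in> paths h K t S w" for y y'
    using that \<open>0 \<le> h\<close> by (intro continuous_intros continuous_on_subset[OF paths_continuous_on]) auto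
  \<comment> \<open>Uniform convergence passes to products when the limits are bounded.\<close>
  have "bounded ((\<lambda>\<eta>. norm (y \<eta> - y' \<eta>)) ` {t..S})"
    by (intro compact_imp_bounded compact_continuous_image c y) auto
  then show "uniform_limit {t..S} (\<lambda>n \<eta>. (norm (Y n \<eta> - Y' n \<eta>))\<^sup>2) (\<lambda>\<eta>. (norm (y \<eta> - y' \<eta>))\<^sup>2) sequentially"
    unfolding power2_eq_square by (intro uniform_lim_mult uniform_limit_paths_diff[OF u \<open>0 \<le> h\<close>])
  show "continuous_on {t..S} (\<lambda>\<eta>. (norm (Y n \<eta> - Y' n \<eta>))\<^sup>2)" for n
    by (intro continuous_on_power c Y)
qed

lemma paths_eval_tendsto:
  assumes Y: "\<And>n. Y n \<in> paths h K t S w" and u: "uniform_limit {t - h..S} Y y sequentially"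
    and \<sigma>: "\<And>n. \<sigma> n \<in> {t..S}" "\<sigma> \<longlonglongrightarrow> c" and "0 \<le> h" "c \<in> {t..S}"
  shows "(\<lambda>n. Y n (\<sigma> n)) \<longlonglongrightarrow> y c"
proof -
  have "(\<lambda>n. Y n (\<sigma> n) - Y n c) \<longlonglongrightarrow> 0"
  proof (rule Lim_null_comparison)
    have "norm (Y n (\<sigma> n) - Y n c) \<le> K * \<bar>\<sigma> n - c\<bar>" for n
      using \<sigma>(1)[of n] \<open>0 \<le> h\<close> \<open>c \<in> _\<close> by (intro paths_lipschitz[OF Y]) auto
    then show "\<forall>\<^sub>F n in sequentially. norm (Y n (\<sigma> n) - Y n c) \<le> K * \<bar>\<sigma> n - c\<bar>" by simp
    show "(\<lambda>n. K * \<bar>\<sigma> n - c\<bar>) \<longlonglongrightarrow> 0"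
      using \<sigma>(2) by (intro tendsto_eq_intros) auto
  qed
  moreover have "(\<lambda>n. Y n c) \<longlonglongrightarrow> y c"
    by (rule tendsto_uniform_limitI[OF u]) (use assms in auto)
  ultimately have "(\<lambda>n. (Y n (\<sigma> n) - Y n c) + Y n c) \<longlonglongrightarrow> 0 + y c" by (rule tendsto_add)
  then show ?thesis by simp
qed

text \<open>Joint continuity in time and path: each of the three terms of the Lipschitz estimate
  tends to 0.\<close>

lemma Phi_paths_tendsto:
  fixes w :: "real \<Rightarrow> real^'n"
  assumes Phi: "\<phi> \<in> class_Phi t0 T h" and h: "0 \<le> h" "0 \<le> K" "t0 \<le> t" "t \<le> S" "S \<le> T"
    and B: "\<forall>\<theta>\<in>{-h..0}. norm (w \<theta>) \<le> B"
    and Y: "\<And>n. Y n \<in> paths h K t S w" "y \<in> paths h K t S w" and u: "uniform_limit {t - h..S} Y y sequentially"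
    and \<sigma>: "\<And>n. \<sigma> n \<in> {t..S}" "\<sigma> \<longlonglongrightarrow> c" and c: "c \<in> {t..S}"
  shows "(\<lambda>n. \<phi> (\<sigma> n) (history h (Y n) (\<sigma> n))) \<longlonglongrightarrow> \<phi> c (history h y c)"
proof -
  obtain M where "M > 0" and M: "\<forall>y\<in>paths h K t S w. \<forall>y'\<in>paths h K t S w. \<forall>s\<in>{t..S}. \<forall>s'\<in>{t..S}. \<bar>\<phi> s (history h y s) - \<phi> s' (history h y' s')\<bar>
        \<le> M * (\<bar>s - s'\<bar> + norm (y s - y' s') + integral {t..min s s'} (\<lambda>\<eta>. norm (y \<eta> - y' \<eta>)))"
    using Phi_paths_lipschitz[OF Phi h B] by blast
  let ?D = "\<lambda>n. integral {t..min (\<sigma> n) c} (\<lambda>\<eta>. norm (Y n \<eta> - y \<eta>))"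
  have "?D \<longlonglongrightarrow> integral {t..min c c} (\<lambda>\<eta>. norm (y \<eta> - y \<eta>))"
  proof (rule tendsto_integral_uniform_limit)
    show "uniform_limit {t..S} (\<lambda>n \<eta>. norm (Y n \<eta> - y \<eta>)) (\<lambda>\<eta>. norm (y \<eta> - y \<eta>)) sequentially"
      by (rule uniform_limit_paths_diff[OF u uniform_limit_const h(1)])
    show "continuous_on {t..S} (\<lambda>\<eta>. norm (Y n \<eta> - y \<eta>))" for n
      using h Y by (intro continuous_intros continuous_on_subset[OF paths_continuous_on]) auto
    show "min (\<sigma> n) c \<in> {t..S}" for n using \<sigma>(1)[of n] c by auto
    show "(\<lambda>n. min (\<sigma> n) c) \<longlonglongrightarrow> min c c" by (rule tendsto_min[OF \<sigma>(2) tendsto_const])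
  qed
  then have D: "?D \<longlonglongrightarrow> 0" by simp
  have "(\<lambda>n. Y n (\<sigma> n) - y c) \<longlonglongrightarrow> 0"
    using paths_eval_tendsto[OF Y(1) u \<sigma> h(1) c] by (simp flip: Lim_null)
  then have e: "(\<lambda>n. norm (Y n (\<sigma> n) - y c)) \<longlonglongrightarrow> 0" by (rule tendsto_norm_zero)
  have "(\<lambda>n. \<sigma> n - c) \<longlonglongrightarrow> 0" using \<sigma>(2) by (simp flip: Lim_null)
  then have "(\<lambda>n. \<bar>\<sigma> n - c\<bar>) \<longlonglongrightarrow> 0" by (rule tendsto_rabs_zero)
  from tendsto_mult_right_zero[OF tendsto_add_zero[OF tendsto_add_zero[OF this e] D], of M]
  have lim: "(\<lambda>n. M * (\<bar>\<sigma> n - c\<bar> + norm (Y n (\<sigma> n) - y c) + ?D n)) \<longlonglongrightarrow> 0" .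
  have "norm (\<phi> (\<sigma> n) (history h (Y n) (\<sigma> n)) - \<phi> c (history h y c))
      \<le> M * (\<bar>\<sigma> n - c\<bar> + norm (Y n (\<sigma> n) - y c) + ?D n)" for n
    unfolding real_norm_def
    by (rule M[THEN bspec, OF Y(1)[of n], THEN bspec, OF Y(2), THEN bspec, OF \<sigma>(1)[of n], THEN bspec, OF c])
  then have "\<forall>\<^sub>F n in sequentially. norm (\<phi> (\<sigma> n) (history h (Y n) (\<sigma> n)) - \<phi> c (history h y c))
      \<le> M * (\<bar>\<sigma> n - c\<bar> + norm (Y n (\<sigma> n) - y c) + ?D n)" by (intro always_eventually allI)
  then have "(\<lambda>n. \<phi> (\<sigma> n) (history h (Y n) (\<sigma> n)) - \<phi> c (history h y c)) \<longlonglongrightarrow> 0"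
    by (rule Lim_null_comparison[OF _ lim])
  then show ?thesis by (rule Lim_null[THEN iffD2])
qed

lemma paths_diff_continuous_on:
  assumes "y \<in> paths h K t S w" "y' \<in> paths h K t S w" "0 \<le> h" "t \<le> a" "b \<le> S"
  shows "continuous_on {a..b} (\<lambda>\<eta>. norm (y \<eta> - y' \<eta>))"
  using assms by (intro continuous_intros continuous_on_subset[OF paths_continuous_on]) auto

subsection \<open>Polygonal extensions\<close>

text \<open>Whereas \<open>polygonal\<close> starts from a history in shifted coordinates, this
  continues the whole path \<open>y\<close> from time \<open>s\<close>. The result still has the
  history \<open>w\<close> at time \<open>t\<close> and can compete in the maximisation.\<close>

definition extend :: "(real \<Rightarrow> real^'n) \<Rightarrow> real \<Rightarrow> real \<Rightarrow> real^'n \<Rightarrow> real \<Rightarrow> real^'n" where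
  "extend y s \<xi> x \<eta> = (if \<eta> \<le> s then y \<eta>
     else if \<eta> \<le> \<xi> then y s + ((\<eta> - s) / (\<xi> - s)) *\<^sub>R (x - y s) else x)"

lemma extend_before [simp]: "\<eta> \<le> s \<Longrightarrow> extend y s \<xi> x \<eta> = y \<eta>"
  by (simp add: extend_def)

lemma extend_end [simp]: "s < \<xi> \<Longrightarrow> extend y s \<xi> x \<xi> = x"
  by (simp add: extend_def)

text \<open>Three \<open>K\<close>-Lipschitz pieces are glued; the cone condition on
  \<open>x\<close> is exactly the slope bound for the middle segment.\<close>

lemma extend_in_paths:
  assumes y: "y \<in> paths h K t S w" and "s \<in> {t..S}" "s < \<xi>" "\<xi> \<le> S" "0 \<le> h" "0 \<le> K"
    and x: "norm (x - y s) \<le> K * (\<xi> - s)"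
  shows "extend y s \<xi> x \<in> paths h K t S w"
proof -
  let ?l = "\<lambda>\<eta>. y s + ((\<eta> - s) / (\<xi> - s)) *\<^sub>R (x - y s)"
  have "K-lipschitz_on {s..\<xi>} ?l"
  proof (rule lipschitz_onI)
    fix a b
    have "dist (?l a) (?l b) = \<bar>a - b\<bar> * (norm (x - y s) / (\<xi> - s))"
    proof -
      have "?l a - ?l b = ((a - b) / (\<xi> - s)) *\<^sub>R (x - y s)"
        by (simp add: scaleR_left_diff_distrib[symmetric] diff_divide_distrib[symmetric])
      then show ?thesis using \<open>s < \<xi>\<close> by (simp add: dist_norm)
    qed
    also have "\<dots> \<le> \<bar>a - b\<bar> * K"
      using x \<open>s < \<xi>\<close> by (intro mult_left_mono) (auto simp: field_simps)
    finally show "dist (?l a) (?l b) \<le> K * dist a b" by (simp add: dist_norm mult.commute)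
  qed fact
  then have 1: "K-lipschitz_on {s..S} (\<lambda>\<eta>. if \<eta> \<le> \<xi> then ?l \<eta> else x)"
    by (rule lipschitz_on_concat[where g = "\<lambda>_. x"])
      (use \<open>s < \<xi>\<close> \<open>0 \<le> K\<close> in \<open>auto intro: lipschitz_on_le[OF lipschitz_on_constant]\<close>)
  have "K-lipschitz_on {t - h..s} y"
    using y \<open>s \<in> _\<close> by (auto simp: paths_def elim: lipschitz_on_subset)
  then have "K-lipschitz_on {t - h..S} (\<lambda>\<eta>. if \<eta> \<le> s then y \<eta> else if \<eta> \<le> \<xi> then ?l \<eta> else x)"
    by (rule lipschitz_on_concat[OF _ 1]) (use \<open>s < \<xi>\<close> in simp)
  then have "K-lipschitz_on {t - h..S} (extend y s \<xi> x)"
    unfolding extend_def .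
  moreover have "extend y s \<xi> x (t + \<theta>) = w \<theta>" if "\<theta> \<in> {-h..0}" for \<theta>
    using that y \<open>s \<in> _\<close> by (simp add: paths_def)
  ultimately show ?thesis by (simp add: paths_def)
qed

text \<open>Turns the projection with base point \<open>(s, history h y s)\<close> into the
  functional along a path. The window ending at \<open>\<xi>\<close> starts after
  \<open>s - h\<close>, so \<open>polygonal\<close> reads the history only inside its
  domain.\<close>

lemma history_polygonal:
  assumes "0 \<le> h" "s < \<xi>"
  shows "history h (polygonal s (history h y s) \<xi> x) \<xi> = history h (extend y s \<xi> x) \<xi>"
  unfolding history_def
  by (rule restrict_ext) (use assms in \<open>auto simp: polygonal_def extend_def\<close>)

text \<open>The energy changes only if \<open>s < s'\<close>, and then only through the values on
  \<open>[s, min \<xi> s']\<close>. There the distance of the paths is bounded by a quantity that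
  depends neither on \<open>\<xi>\<close> nor on the extension, so the increase is linear in
  \<open>\<xi> - s\<close>.\<close>

lemma energy_extension_le:
  assumes y: "y \<in> paths h K t S w" and y': "y' \<in> paths h K t S w" and v: "v \<in> paths h K t S w"
    and eq: "\<And>\<eta>. \<eta> \<le> s \<Longrightarrow> v \<eta> = y \<eta>" and s: "t \<le> s" "s < \<xi>" "\<xi> \<le> S" "s' \<in> {t..S}"
    and "0 \<le> h" "0 \<le> K"
  shows "energy t (min \<xi> s') v y' \<le> energy t (min s s') y y'
    + (K * \<bar>s - s'\<bar> + norm (y s - y' s'))\<^sup>2 * (\<xi> - s)"
proof (cases "s' \<le> s")
  case True
  then have "min \<xi> s' = s'" "min s s' = s'" using s by auto
  moreover have "energy t s' v y' = energy t s' y y'"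
    unfolding energy_def by (rule integral_cong) (use eq True in auto)
  ultimately show ?thesis using s by simp
next
  case False
  define m where "m = min \<xi> s'"
  define q where "q = K * \<bar>s - s'\<bar> + norm (y s - y' s')"
  have m: "s \<le> m" "m \<le> s'" "m \<le> \<xi>" "m \<le> S" using False s by (auto simp: m_def)
  let ?e = "\<lambda>v \<eta>. (norm (v \<eta> - y' \<eta>))\<^sup>2"
  have c: "continuous_on {a..b} (?e v)" if "t \<le> a" "b \<le> S" for a b
    using that by (intro continuous_on_power paths_diff_continuous_on[OF v y'] \<open>0 \<le> h\<close>)
  have "norm (integral {s..m} (?e v)) \<le> q\<^sup>2 * (m - s)"
  proof (rule integral_bound)
    fix \<eta> assume \<eta>: "\<eta> \<in> {s..m}"
    have "norm (v \<eta> - v s) \<le> K * \<bar>\<eta> - s\<bar>" "norm (y' s' - y' \<eta>) \<le> K * \<bar>s' - \<eta>\<bar>"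
      by (rule paths_lipschitz[OF v] paths_lipschitz[OF y']; use \<eta> m s \<open>0 \<le> h\<close> in simp)+
    moreover have "norm (v \<eta> - y' \<eta>) \<le> norm (v \<eta> - v s) + norm (v s - y' s') + norm (y' s' - y' \<eta>)"
      by norm
    moreover have "v s = y s" by (simp add: eq)
    \<comment> \<open>Since \<open>\<eta>\<close> lies between \<open>s\<close> and
      \<open>s'\<close>, moving \<open>v\<close> back to \<open>s\<close> and \<open>y'\<close>
      forward to \<open>s'\<close> together costs exactly this.\<close>
    moreover have "K * \<bar>\<eta> - s\<bar> + K * \<bar>s' - \<eta>\<bar> = K * \<bar>s - s'\<bar>"
      using \<eta> m by (simp add: algebra_simps)
    ultimately have "norm (v \<eta> - y' \<eta>) \<le> q" by (simp add: q_def)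
    then show "norm (?e v \<eta>) \<le> q\<^sup>2" by (simp add: power_mono)
  qed (use m s c in auto)
  also have "\<dots> \<le> q\<^sup>2 * (\<xi> - s)" using m by (intro mult_left_mono) auto
  finally have "integral {s..m} (?e v) \<le> q\<^sup>2 * (\<xi> - s)" by simp
  moreover have "integral {t..s} (?e v) + integral {s..m} (?e v) = integral {t..m} (?e v)"
    using m s by (intro Henstock_Kurzweil_Integration.integral_combine integrable_continuous_real c) auto
  moreover have "integral {t..s} (?e v) = integral {t..s} (?e y)"
    by (rule integral_cong) (simp add: eq)
  ultimately show ?thesis
    using False unfolding energy_def m_def[symmetric] q_def[symmetric] by simp
qed

text \<open>The distance of the paths vanishes at \<open>t\<close> and is
  \<open>2 * K\<close>-Lipschitz. If it equals \<open>e\<close> at \<open>\<eta>\<close>, it is at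
  least \<open>e / 2\<close> on an interval of length \<open>e / (4 * K)\<close> to the left of
  \<open>\<eta>\<close>, which contributes \<open>e\<^sup>2 / (8 * K)\<close> to the
  integral.\<close>

lemma paths_diff_sq_le_L1:
  assumes y: "y \<in> paths h K t S w" and y': "y' \<in> paths h K t S w" and \<eta>: "\<eta> \<in> {t..S}"
    and "0 \<le> h" "0 \<le> K"
  shows "(norm (y \<eta> - y' \<eta>))\<^sup>2 \<le> 8 * K * integral {t..\<eta>} (\<lambda>\<eta>. norm (y \<eta> - y' \<eta>))"
proof -
  let ?d = "\<lambda>\<eta>. norm (y \<eta> - y' \<eta>)"
  define e where "e = ?d \<eta>"
  have lip: "e - ?d \<zeta> \<le> 2 * K * (\<eta> - \<zeta>)" if "\<zeta> \<in> {t..\<eta>}" for \<zeta>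
  proof -
    have "norm (y \<eta> - y \<zeta>) \<le> K * \<bar>\<eta> - \<zeta>\<bar>" "norm (y' \<eta> - y' \<zeta>) \<le> K * \<bar>\<eta> - \<zeta>\<bar>"
      by (rule paths_lipschitz[OF y] paths_lipschitz[OF y']; use that \<eta> \<open>0 \<le> h\<close> in simp)+
    moreover have "e \<le> ?d \<zeta> + norm (y \<eta> - y \<zeta>) + norm (y' \<eta> - y' \<zeta>)"
      unfolding e_def by norm
    ultimately show ?thesis using that by simp
  qed
  have c: "continuous_on {a..b} ?d" if "t \<le> a" "b \<le> S" for a b
    using that by (intro paths_diff_continuous_on[OF y y'] \<open>0 \<le> h\<close>)
  have "?d t = 0"
    using paths_history[OF y, of t] paths_history[OF y', of t] \<open>0 \<le> h\<close> by simp
  then have e_le: "e \<le> 2 * K * (\<eta> - t)" using lip[of t] \<eta> by simp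
  show ?thesis
  proof (cases "K = 0")
    case True
    then show ?thesis using e_le by (simp add: e_def)
  next
    case False
    then have "K > 0" using \<open>0 \<le> K\<close> by simp
    define \<delta> where "\<delta> = e / (4 * K)"
    \<comment> \<open>The interval of length \<open>\<delta>\<close> stays inside
      \<open>[t, \<eta>]\<close>: growing from 0 at \<open>t\<close> to \<open>e\<close> takes at
      least time \<open>2 * \<delta>\<close>.\<close>
    have "0 \<le> K * (\<eta> - t)" using \<open>K > 0\<close> \<eta> by simp
    then have "e \<le> (\<eta> - t) * (4 * K)" using e_le by (simp add: algebra_simps)
    then have "\<delta> \<le> \<eta> - t" using \<open>K > 0\<close> by (simp add: \<delta>_def pos_divide_le_eq)
    then have \<delta>: "0 \<le> \<delta>" "t \<le> \<eta> - \<delta>"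
      using \<open>K > 0\<close> by (auto simp: \<delta>_def e_def)
    have "e\<^sup>2 / (8 * K) = integral {\<eta> - \<delta>..\<eta>} (\<lambda>_. e / 2)"
      using \<delta> \<open>K > 0\<close> by (simp add: \<delta>_def power2_eq_square)
    also have "\<dots> \<le> integral {\<eta> - \<delta>..\<eta>} ?d"
    proof (rule integral_le)
      fix \<zeta> assume \<zeta>: "\<zeta> \<in> {\<eta> - \<delta>..\<eta>}"
      have "2 * K * (\<eta> - \<zeta>) \<le> 2 * K * \<delta>" using \<zeta> \<open>K > 0\<close> by simp
      also have "\<dots> = e / 2" using \<open>K > 0\<close> by (simp add: \<delta>_def)
      finally show "e / 2 \<le> ?d \<zeta>" using lip[of \<zeta>] \<zeta> \<delta> by simp
    qed (use \<delta> \<eta> c in \<open>auto intro!: integrable_continuous_real\<close>)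
    also have "\<dots> \<le> integral {t..\<eta>} ?d"
      using \<delta> \<eta> by (intro integral_subset_le integrable_continuous_real c) auto
    finally show ?thesis using \<open>K > 0\<close> by (simp add: e_def field_simps)
  qed
qed

text \<open>Both delayed values are compared with the values at one common time not exceeding
  \<open>min s s'\<close>, where the integral controls the distance. The Lipschitz bound pays for
  the two time shifts.\<close>

lemma paths_delayed_diff_le:
  assumes y: "y \<in> paths h K t S w" and y': "y' \<in> paths h K t S w" and s: "s \<in> {t..S}" "s' \<in> {t..S}"
    and a: "a \<in> {t - h..s}" "b \<in> {t - h..s'}" and "0 \<le> h" "0 \<le> K"
  shows "norm (y a - y' b) \<le> K * (2 * \<bar>s - s'\<bar> + \<bar>a - b\<bar>)
    + sqrt (8 * K * integral {t..min s s'} (\<lambda>\<eta>. norm (y \<eta> - y' \<eta>)))"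
proof -
  let ?d = "\<lambda>\<eta>. norm (y \<eta> - y' \<eta>)"
  have c: "continuous_on {a..b} ?d" if "t \<le> a" "b \<le> S" for a b
    using that by (intro paths_diff_continuous_on[OF y y'] \<open>0 \<le> h\<close>)
  \<comment> \<open>Because \<open>a \<le> s\<close>, the truncation moves \<open>a\<close> by at
    most \<open>\<bar>s - s'\<bar>\<close>.\<close>
  define \<eta> where "\<eta> = min a (min s s')"
  have \<eta>: "\<eta> \<in> {t - h..min s s'}" "\<bar>a - \<eta>\<bar> \<le> \<bar>s - s'\<bar>" using a s \<open>0 \<le> h\<close> by (auto simp: \<eta>_def)
  have "?d \<eta> \<le> sqrt (8 * K * integral {t..min s s'} ?d)"
  proof (rule real_le_rsqrt)
    show "(?d \<eta>)\<^sup>2 \<le> 8 * K * integral {t..min s s'} ?d"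
    proof (cases "\<eta> \<le> t")
      case True
      then have "?d \<eta> = 0"
        using paths_history[OF y, of \<eta>] paths_history[OF y', of \<eta>] \<eta> by simp
      moreover have "0 \<le> integral {t..min s s'} ?d"
        using s by (intro integral_nonneg integrable_continuous_real c) auto
      ultimately show ?thesis using \<open>0 \<le> K\<close> by simp
    next
      case False
      then have "(?d \<eta>)\<^sup>2 \<le> 8 * K * integral {t..\<eta>} ?d"
        using \<eta> s by (intro paths_diff_sq_le_L1[OF y y'] \<open>0 \<le> h\<close> \<open>0 \<le> K\<close>) auto
      also have "\<dots> \<le> 8 * K * integral {t..min s s'} ?d"
        using \<eta> s \<open>0 \<le> K\<close>
        by (intro mult_left_mono integral_subset_le integrable_continuous_real c) auto
      finally show ?thesis .
    qed
  qed
  moreover have "norm (y a - y \<eta>) \<le> K * \<bar>s - s'\<bar>"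
  proof -
    have "norm (y a - y \<eta>) \<le> K * \<bar>a - \<eta>\<bar>" using a \<eta> s by (intro paths_lipschitz[OF y]) auto
    also have "\<dots> \<le> K * \<bar>s - s'\<bar>" using \<eta> \<open>0 \<le> K\<close> by (intro mult_left_mono) auto
    finally show ?thesis .
  qed
  moreover have "norm (y' \<eta> - y' b) \<le> K * (\<bar>s - s'\<bar> + \<bar>a - b\<bar>)"
  proof -
    have "norm (y' \<eta> - y' b) \<le> K * \<bar>\<eta> - b\<bar>" using a \<eta> s by (intro paths_lipschitz[OF y']) auto
    also have "\<dots> \<le> K * (\<bar>s - s'\<bar> + \<bar>a - b\<bar>)" using \<eta> \<open>0 \<le> K\<close> by (intro mult_left_mono) auto
    finally show ?thesis .
  qed
  moreover have "norm (y a - y' b) \<le> norm (y a - y \<eta>) + ?d \<eta> + norm (y' \<eta> - y' b)" by norm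
  ultimately show ?thesis by (simp add: algebra_simps)
qed

section \<open>Uniform continuity of the Hamiltonian on bounded sets\<close>

lemma Hamiltonian_uniformly_continuous:
  fixes f :: "real \<Rightarrow> real^'n \<Rightarrow> real^'n \<Rightarrow> real^'m \<Rightarrow> real^'n"
    and L :: "real \<Rightarrow> real^'n \<Rightarrow> real^'n \<Rightarrow> real^'m \<Rightarrow> real"
  assumes A: "A \<noteq> {}" "compact A"
    and f: "continuous_on ({t0..T} \<times> UNIV \<times> UNIV \<times> A) (\<lambda>(t, z, y, a). f t z y a)"
    and L: "continuous_on ({t0..T} \<times> UNIV \<times> UNIV \<times> A) (\<lambda>(t, z, y, a). L t z y a)"
    and "e > 0"
  obtains d where "d > 0"
    "\<And>(s :: real) s' (z :: real^'n) z' (y :: real^'n) y' p. \<lbrakk>s \<in> {t0..T}; s' \<in> {t0..T}; norm z \<le> B; norm z' \<le> B; norm y \<le> B; norm y' \<le> B;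
      norm p \<le> B; \<bar>s - s'\<bar> < d; norm (z - z') < d; norm (y - y') < d\<rbrakk> \<Longrightarrow>
      Hamiltonian A f L s z y p - Hamiltonian A f L s' z' y' p \<le> e"
proof -
  define G where "G = (\<lambda>(t, z, y, p, a). f t z y a \<bullet> p + L t z y a)"
  define X where "X = {t0..T} \<times> cball (0::real^'n) B \<times> cball (0::real^'n) B \<times> cball (0::real^'n) B \<times> A"
  have "continuous_on X (\<lambda>(t, z, y, p, a). f t z y a)" "continuous_on X (\<lambda>(t, z, y, p, a). L t z y a)"
    unfolding X_def case_prod_unfold
    by (rule continuous_on_compose2[OF f[unfolded case_prod_unfold], where f = "\<lambda>q. (fst q, fst (snd q), fst (snd (snd q)), snd (snd (snd (snd q))))", simplified];
        force intro!: continuous_intros)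
      (rule continuous_on_compose2[OF L[unfolded case_prod_unfold], where f = "\<lambda>q. (fst q, fst (snd q), fst (snd (snd q)), snd (snd (snd (snd q))))", simplified];
        force intro!: continuous_intros)
  then have G: "continuous_on X G"
    unfolding G_def case_prod_unfold by (intro continuous_intros)
  have "compact X" unfolding X_def using A by (intro compact_Times) auto
  with G have "uniformly_continuous_on X G" by (rule compact_uniformly_continuous)
  moreover have "e > 0" by fact
  ultimately obtain d where "d > 0" and d: "\<And>q q'. q \<in> X \<Longrightarrow> q' \<in> X \<Longrightarrow> dist q' q < d \<Longrightarrow> dist (G q') (G q) < e"
    unfolding uniformly_continuous_on_def by meson
  show thesis
  \<comment> \<open>The distance of the arguments is at most the sum of three increments, in time,
    state and delayed state; the gradient and the control are the same on both sides.\<close>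
  proof (rule that[of "d / 3"])
    show "d / 3 > 0" using \<open>d > 0\<close> by simp
    fix s s' :: real and z z' y y' p :: "real^'n"
    assume q: "s \<in> {t0..T}" "s' \<in> {t0..T}" "norm z \<le> B" "norm z' \<le> B" "norm y \<le> B" "norm y' \<le> B"
      "norm p \<le> B" "\<bar>s - s'\<bar> < d / 3" "norm (z - z') < d / 3" "norm (y - y') < d / 3"
    have bdd: "bdd_below ((\<lambda>a. f s z y a \<bullet> p + L s z y a) ` A)"
    proof -
      have "continuous_on A (\<lambda>a. G (s, z, y, p, a))"
        by (rule continuous_on_compose2[OF G]) (use q in \<open>auto simp: X_def intro!: continuous_intros\<close>)
      then have "compact ((\<lambda>a. G (s, z, y, p, a)) ` A)" using A by (intro compact_continuous_image)
      then show ?thesis by (intro bounded_imp_bdd_below compact_imp_bounded) (simp add: G_def)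
    qed
    \<comment> \<open>The modulus is uniform in the control, hence passes to the infimum.\<close>
    have "Hamiltonian A f L s z y p - e \<le> f s' z' y' a \<bullet> p + L s' z' y' a" if "a \<in> A" for a
    proof -
      have "dist (s, z, y, p, a) (s', z', y', p, a) \<le> \<bar>s - s'\<bar> + (norm (z - z') + norm (y - y'))"
        unfolding dist_norm
        by (simp, rule order_trans[OF norm_Pair_le]) (auto intro!: order_trans[OF norm_Pair_le])
      then have "dist (G (s, z, y, p, a)) (G (s', z', y', p, a)) < e"
        using q that by (intro d) (auto simp: X_def)
      then have "f s z y a \<bullet> p + L s z y a - e \<le> f s' z' y' a \<bullet> p + L s' z' y' a"
        by (simp add: G_def dist_real_def)
      moreover have "Hamiltonian A f L s z y p \<le> f s z y a \<bullet> p + L s z y a"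
        unfolding Hamiltonian_def by (rule cINF_lower[OF bdd that])
      ultimately show ?thesis by simp
    qed
    then have "Hamiltonian A f L s z y p - e \<le> Hamiltonian A f L s' z' y' p"
      unfolding Hamiltonian_def[of A f L s'] by (intro cINF_greatest A)
    then show "Hamiltonian A f L s z y p - Hamiltonian A f L s' z' y' p \<le> e" by simp
  qed
qed

subsection \<open>The penalised maximum\<close>

definition penalty :: "real \<Rightarrow> real \<Rightarrow> real \<Rightarrow> (real \<Rightarrow> real^'n) \<Rightarrow> real \<Rightarrow> (real \<Rightarrow> real^'n) \<Rightarrow> real" where
  "penalty \<epsilon> t s y s' y' = ((s - s')\<^sup>2 + (norm (y s - y' s'))\<^sup>2 + energy t (min s s') y y') / \<epsilon>"

lemma penalty_commute: "penalty \<epsilon> t s y s' y' = penalty \<epsilon> t s' y' s y"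
  by (simp add: penalty_def energy_def power2_commute norm_minus_commute min.commute)

lemma penalty_same [simp]: "penalty \<epsilon> t s y s y = 0"
  by (simp add: penalty_def energy_def)

text \<open>The term with \<open>\<gamma>\<close> rewards late times and later makes the viscosity
  inequalities strict. Attainment follows from compactness of the set of values in the reals, which
  is reduced to sequences of times and paths.\<close>

lemma penalized_maximum_exists:
  fixes w :: "real \<Rightarrow> real^'n"
  assumes Phi: "\<phi>1 \<in> class_Phi t0 T h" "\<phi>2 \<in> class_Phi t0 T h"
    and h: "0 \<le> h" "0 \<le> K" "t0 \<le> t" "t \<le> S" "S \<le> T"
    and B: "\<forall>\<theta>\<in>{-h..0}. norm (w \<theta>) \<le> B" and ne: "paths h K t S w \<noteq> {}" and "\<epsilon> > 0"
  obtains s y s' y' where "s \<in> {t..S}" "y \<in> paths h K t S w" "s' \<in> {t..S}" "y' \<in> paths h K t S w"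
    "\<forall>r\<in>{t..S}. \<forall>v\<in>paths h K t S w. \<forall>r'\<in>{t..S}. \<forall>v'\<in>paths h K t S w.
      \<phi>1 r (history h v r) - \<phi>2 r' (history h v' r') - penalty \<epsilon> t r v r' v' + \<gamma> * (r + r')
      \<le> \<phi>1 s (history h y s) - \<phi>2 s' (history h y' s') - penalty \<epsilon> t s y s' y' + \<gamma> * (s + s')"
proof -
  define F where "F = (\<lambda>(r, v, r', v'). \<phi>1 r (history h v r) - \<phi>2 r' (history h v' r')
    - penalty \<epsilon> t r v r' v' + \<gamma> * (r + r'))"
  define Q where "Q = {t..S} \<times> paths h K t S w \<times> {t..S} \<times> paths h K t S w"
  have "compact (F ` Q)"
    unfolding compact_eq_seq_compact_metric seq_compact_def
  proof (intro allI impI)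
    fix g :: "nat \<Rightarrow> real" assume "\<forall>n. g n \<in> F ` Q"
    then have "\<forall>n. \<exists>q. q \<in> Q \<and> g n = F q" by blast
    then obtain q where q: "\<And>n. q n \<in> Q" "\<And>n. g n = F (q n)" by metis
    define r v r' v' where "r = (\<lambda>n. fst (q n))" and "v = (\<lambda>n. fst (snd (q n)))"
      and "r' = (\<lambda>n. fst (snd (snd (q n))))" and "v' = (\<lambda>n. snd (snd (snd (q n))))"
    have rv: "r n \<in> {t..S}" "v n \<in> paths h K t S w" "r' n \<in> {t..S}" "v' n \<in> paths h K t S w"
      "q n = (r n, v n, r' n, v' n)" for n
      using q(1)[of n] by (auto simp: r_def v_def r'_def v'_def Q_def)
    have sc: "seq_compact {t..S}" by (simp add: compact_imp_seq_compact)
    \<comment> \<open>Four successive extractions, for two times and two paths; the composite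
      \<open>k\<close> makes all of them converge at once.\<close>
    obtain k1 s where k1: "strict_mono k1" "s \<in> {t..S}" "(\<lambda>n. r (k1 n)) \<longlonglongrightarrow> s"
      using seq_compactE[OF sc, of r] rv(1) unfolding o_def by metis
    obtain k2 s' where k2: "strict_mono k2" "s' \<in> {t..S}" "(\<lambda>n. r' (k1 (k2 n))) \<longlonglongrightarrow> s'"
      using seq_compactE[OF sc, of "\<lambda>n. r' (k1 n)"] rv(3) unfolding o_def by metis
    obtain y k3 where k3: "y \<in> paths h K t S w" "strict_mono k3"
      "uniform_limit {t - h..S} (\<lambda>n. v (k1 (k2 (k3 n)))) y sequentially"
      by (rule paths_convergent_subsequence[of "\<lambda>n. v (k1 (k2 n))", OF rv(2) h(1,2,4) B])
    obtain y' k4 where k4: "y' \<in> paths h K t S w" "strict_mono k4"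
      "uniform_limit {t - h..S} (\<lambda>n. v' (k1 (k2 (k3 (k4 n))))) y' sequentially"
      by (rule paths_convergent_subsequence[of "\<lambda>n. v' (k1 (k2 (k3 n)))", OF rv(4) h(1,2,4) B])
    define k where "k = (\<lambda>n. k1 (k2 (k3 (k4 n))))"
    have k: "strict_mono k"
      using k1(1) k2(1) k3(2) k4(2) by (simp add: strict_mono_def k_def)
    have lr: "(\<lambda>n. r (k n)) \<longlonglongrightarrow> s"
      using LIMSEQ_subseq_LIMSEQ[OF k1(3), of "\<lambda>n. k2 (k3 (k4 n))"] k2(1) k3(2) k4(2)
      by (simp add: strict_mono_def k_def o_def)
    have lr': "(\<lambda>n. r' (k n)) \<longlonglongrightarrow> s'"
      using LIMSEQ_subseq_LIMSEQ[OF k2(3), of "\<lambda>n. k3 (k4 n)"] k3(2) k4(2)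
      by (simp add: strict_mono_def k_def o_def)
    have "filterlim k4 sequentially sequentially" by (rule filterlim_subseq) fact
    then have u: "uniform_limit {t - h..S} (\<lambda>n. v (k n)) y sequentially"
      unfolding k_def by (rule filterlim_compose[OF k3(3)])
    have u': "uniform_limit {t - h..S} (\<lambda>n. v' (k n)) y' sequentially"
      unfolding k_def by (rule k4(3))
    have "(\<lambda>n. min (r (k n)) (r' (k n))) \<longlonglongrightarrow> min s s'" by (rule tendsto_min[OF lr lr'])
    moreover have "min (r (k n)) (r' (k n)) \<in> {t..S}" for n using rv(1,3)[of "k n"] by auto
    ultimately have e: "(\<lambda>n. energy t (min (r (k n)) (r' (k n))) (v (k n)) (v' (k n))) \<longlonglongrightarrow> energy t (min s s') y y'"
      by (intro energy_tendsto[OF rv(2) rv(4) k3(1) k4(1) h(1) u u'])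
    note l1 = Phi_paths_tendsto[OF Phi(1) h B rv(2) k3(1) u rv(1) lr k1(2)]
    note l2 = Phi_paths_tendsto[OF Phi(2) h B rv(4) k4(1) u' rv(3) lr' k2(2)]
    note d = tendsto_diff[OF paths_eval_tendsto[OF rv(2) u rv(1) lr h(1) k1(2)]
        paths_eval_tendsto[OF rv(4) u' rv(3) lr' h(1) k2(2)]]
    have "\<epsilon> \<noteq> 0" using \<open>\<epsilon> > 0\<close> by simp
    note p = tendsto_divide[OF tendsto_add[OF tendsto_add[OF tendsto_power[OF tendsto_diff[OF lr lr'], of 2]
          tendsto_power[OF tendsto_norm[OF d], of 2]] e] tendsto_const[of \<epsilon>] this]
    have "(\<lambda>n. F (r (k n), v (k n), r' (k n), v' (k n))) \<longlonglongrightarrow> F (s, y, s', y')"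
      unfolding F_def penalty_def prod.case
      by (rule tendsto_add[OF tendsto_diff[OF tendsto_diff[OF l1 l2] p] tendsto_mult[OF tendsto_const tendsto_add[OF lr lr']]])
    then have "(g \<circ> k) \<longlonglongrightarrow> F (s, y, s', y')" by (simp add: o_def q(2) rv(5))
    moreover have "F (s, y, s', y') \<in> F ` Q"
      using k1(2) k2(2) k3(1) k4(1) by (auto simp: Q_def)
    ultimately show "\<exists>l\<in>F ` Q. \<exists>k. strict_mono k \<and> (g \<circ> k) \<longlonglongrightarrow> l" using k by blast
  qed
  moreover have "F ` Q \<noteq> {}" using ne h(4) by (auto simp: Q_def)
  ultimately have "\<exists>m\<in>F ` Q. \<forall>x\<in>F ` Q. x \<le> m" by (rule compact_attains_sup)
  then obtain m where "m \<in> F ` Q" and m: "\<forall>x\<in>F ` Q. x \<le> m" ..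
  then obtain s y s' y' where sy: "s \<in> {t..S}" "y \<in> paths h K t S w" "s' \<in> {t..S}" "y' \<in> paths h K t S w"
    and "m = F (s, y, s', y')" by (auto simp: Q_def)
  show thesis
  proof (rule that[OF sy], intro ballI)
    fix r v r' v'
    assume "r \<in> {t..S}" "v \<in> paths h K t S w" "r' \<in> {t..S}" "v' \<in> paths h K t S w"
    then have "F (r, v, r', v') \<le> F (s, y, s', y')"
      using bspec[OF m, of "F (r, v, r', v')"] \<open>m = _\<close> by (simp add: Q_def)
    then show "\<phi>1 r (history h v r) - \<phi>2 r' (history h v' r') - penalty \<epsilon> t r v r' v' + \<gamma> * (r + r')
      \<le> \<phi>1 s (history h y s) - \<phi>2 s' (history h y' s') - penalty \<epsilon> t s y s' y' + \<gamma> * (s + s')"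
      by (simp add: F_def)
  qed
qed

section \<open>Viscosity inequalities at the penalised maximum\<close>

lemma supersolution_uminus:
  assumes "viscosity_supersolution t0 T h \<tau> Cf H \<phi>"
  shows "viscosity_subsolution t0 T h \<tau> Cf (\<lambda>t z y p. - H t z y (- p)) (\<lambda>s w. - \<phi> s w)"
  unfolding viscosity_subsolution_def
proof (intro conjI ballI allI impI)
  have "\<bar>- a - - b\<bar> = \<bar>a - b\<bar>" for a b :: real by simp
  moreover have "\<phi> \<in> class_Phi t0 T h" using assms by (simp add: viscosity_supersolution_def)
  ultimately show "(\<lambda>s w. - \<phi> s w) \<in> class_Phi t0 T h"
    by (simp only: class_Phi_def mem_Collect_eq)
next
  fix t w u ut uz C \<delta>
  assume t: "t \<in> {t0..<T}" "w \<in> Lip h"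
    and *: "C1_with UNIV u ut uz \<and> Cf * (1 + 2 * sup_norm h w) < C \<and> 0 < \<delta> \<and> t + \<delta> \<le> T \<and>
       (\<forall>(s, x)\<in>cone t (t + \<delta>) (w 0) C. projection h (\<lambda>s w. - \<phi> s w) t w s x - u s x
          \<le> projection h (\<lambda>s w. - \<phi> s w) t w t (w 0) - u t (w 0))"
  have C1: "C1_with UNIV (\<lambda>s x. - u s x) (\<lambda>s x. - ut s x) (\<lambda>s x. - uz s x)"
    unfolding C1_with_def
  proof (intro conjI ballI allI)
    fix s x
    have "((\<lambda>(s, x). u s x) has_derivative (\<lambda>(k, v). ut s x * k + uz s x \<bullet> v)) (at (s, x) within UNIV \<times> UNIV)"
      using * by (simp add: C1_with_def)
    then have "((\<lambda>q. - (case q of (s, x) \<Rightarrow> u s x)) has_derivative (\<lambda>q. - (case q of (k, v) \<Rightarrow> ut s x * k + uz s x \<bullet> v)))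
      (at (s, x) within UNIV \<times> UNIV)" by (rule has_derivative_minus)
    then show "((\<lambda>(s, x). - u s x) has_derivative (\<lambda>(k, v). - ut s x * k + - uz s x \<bullet> v)) (at (s, x) within UNIV \<times> UNIV)"
      by (simp add: case_prod_unfold)
  next
    have "continuous_on (UNIV \<times> UNIV) (\<lambda>(t, z). ut t z)" "continuous_on (UNIV \<times> UNIV) (\<lambda>(t, z). uz t z)"
      using * by (auto simp: C1_with_def)
    then show "continuous_on (UNIV \<times> UNIV) (\<lambda>(t, z). - ut t z)" "continuous_on (UNIV \<times> UNIV) (\<lambda>(t, z). - uz t z)"
      unfolding case_prod_unfold by (auto intro!: continuous_intros)
  qed
  \<comment> \<open>A maximum of the negated projection minus \<open>u\<close> is a minimum of the
    projection minus \<open>- u\<close>. The gradient of \<open>- u\<close> explains the reflected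
    argument in the Hamiltonian.\<close>
  have "projection h (\<lambda>s w. - \<phi> s w) t w s x = - projection h \<phi> t w s x" for s x
    by (simp add: projection_def)
  then have touch: "\<forall>(s, x)\<in>cone t (t + \<delta>) (w 0) C. projection h \<phi> t w t (w 0) - - u t (w 0) \<le> projection h \<phi> t w s x - - u s x"
    using * by (simp only: case_prod_unfold) (simp add: algebra_simps)
  with * C1 have conj: "C1_with UNIV (\<lambda>s x. - u s x) (\<lambda>s x. - ut s x) (\<lambda>s x. - uz s x) \<and>
      C > Cf * (1 + 2 * sup_norm h w) \<and> \<delta> > 0 \<and> t + \<delta> \<le> T \<and> (\<forall>(s, x)\<in>cone t (t + \<delta>) (w 0) C.
        projection h \<phi> t w t (w 0) - - u t (w 0) \<le> projection h \<phi> t w s x - - u s x)"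
    by (intro conjI) simp_all
  have "- ut t (w 0) + H t (w 0) (w (- \<tau> t (w 0))) (- uz t (w 0)) \<le> 0"
    by (rule assms[unfolded viscosity_supersolution_def, THEN conjunct2, THEN bspec, OF t(1), THEN bspec, OF t(2),
        THEN spec, THEN spec, THEN spec, THEN spec, THEN spec, THEN mp])
      (rule conj)
  then show "0 \<le> ut t (w 0) + - H t (w 0) (w (- \<tau> t (w 0))) (- uz t (w 0))" by simp
qed

lemma C1_with_quadratic:
  fixes z' :: "real^'n"
  assumes "\<epsilon> \<noteq> 0"
  shows "C1_with UNIV (\<lambda>s x. ((s - s')\<^sup>2 + (norm (x - z'))\<^sup>2) / \<epsilon> - c * s)
    (\<lambda>s x. 2 * (s - s') / \<epsilon> - c) (\<lambda>s x. (2 / \<epsilon>) *\<^sub>R (x - z'))"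
  unfolding C1_with_def
proof (intro conjI ballI allI)
  fix s :: real and x :: "real^'n"
  \<comment> \<open>The squared norm is written as an inner product, since the norm itself is not
    differentiable at 0.\<close>
  have "((\<lambda>q. ((fst q - s')\<^sup>2 + (snd q - z') \<bullet> (snd q - z')) / \<epsilon> - c * fst q) has_derivative
     (\<lambda>q. (2 * (s - s') * fst q + 2 * ((x - z') \<bullet> snd q)) / \<epsilon> - c * fst q)) (at (s, x))"
    by (intro has_derivative_diff bounded_linear.has_derivative[OF bounded_linear_divide])
      (auto intro!: derivative_eq_intros simp: inner_commute algebra_simps)
  moreover have "(2 * (s - s') * fst q + 2 * ((x - z') \<bullet> snd q)) / \<epsilon> - c * fst q
     = (2 * (s - s') / \<epsilon> - c) * fst q + ((2 / \<epsilon>) *\<^sub>R (x - z')) \<bullet> snd q" for q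
    unfolding inner_scaleR_left by (simp add: add_divide_distrib diff_divide_distrib algebra_simps)
  ultimately show "((\<lambda>(s, x). ((s - s')\<^sup>2 + (norm (x - z'))\<^sup>2) / \<epsilon> - c * s) has_derivative
     (\<lambda>(k, v). (2 * (s - s') / \<epsilon> - c) * k + ((2 / \<epsilon>) *\<^sub>R (x - z')) \<bullet> v)) (at (s, x) within UNIV \<times> UNIV)"
    by (simp add: case_prod_unfold power2_norm_eq_inner)
qed (auto simp: case_prod_unfold assms intro!: continuous_intros)

text \<open>With \<open>(s', y')\<close> frozen, the maximum over all paths is restricted to
  polygonal extensions of \<open>y\<close> beyond \<open>s\<close>. The quadratic part of the
  penalty becomes the test function; the energy is no function of the end point, but its growth is
  at most linear and is absorbed by half of the \<open>\<gamma>\<close> term.\<close>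

lemma subsolution_at_penalized_maximum:
  fixes w :: "real \<Rightarrow> real^'n"
  assumes sub: "viscosity_subsolution t0 T h \<tau> Cf H \<phi>"
    and h: "0 \<le> h" "0 \<le> K" "t0 \<le> t" "S \<le> T" "0 < Cf"
    and B: "\<forall>\<theta>\<in>{-h..0}. norm (w \<theta>) \<le> B" and K: "Cf * (1 + 2 * (B + K * (S - t))) < K"
    and \<tau>: "0 \<le> \<tau> s (y s)" "\<tau> s (y s) \<le> h"
    and y: "y \<in> paths h K t S w" "y' \<in> paths h K t S w" and s: "s \<in> {t..<S}" "s' \<in> {t..S}"
    and "\<epsilon> > 0" and small: "(K * \<bar>s - s'\<bar> + norm (y s - y' s'))\<^sup>2 \<le> \<epsilon> * (\<gamma> / 2)"
    and max: "\<And>\<xi> v. \<xi> \<in> {t..S} \<Longrightarrow> v \<in> paths h K t S w \<Longrightarrow>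
      \<phi> \<xi> (history h v \<xi>) - penalty \<epsilon> t \<xi> v s' y' + \<gamma> * \<xi> \<le> \<phi> s (history h y s) - penalty \<epsilon> t s y s' y' + \<gamma> * s"
  shows "0 \<le> 2 * (s - s') / \<epsilon> - \<gamma> / 2 + H s (y s) (y (s - \<tau> s (y s))) ((2 / \<epsilon>) *\<^sub>R (y s - y' s'))"
proof -
  let ?w = "history h y s"
  \<comment> \<open>Only \<open>\<gamma> / 2\<close> is kept here; the other half pays for the
    growth of the energy.\<close>
  let ?u = "\<lambda>\<xi> x. ((\<xi> - s')\<^sup>2 + (norm (x - y' s'))\<^sup>2) / \<epsilon> - \<gamma> / 2 * \<xi>"
  have w: "?w \<in> Lip h"
    by (rule history_in_Lip[OF paths_lipschitz_history[OF y(1)]]) (use s in auto)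
  have w0: "?w 0 = y s" "?w (- \<tau> s (y s)) = y (s - \<tau> s (y s))" using h \<tau> by simp_all
  have "sup_norm h ?w \<le> B + K * (S - t)"
    by (rule sup_norm_history_le[OF h(1)], rule paths_norm_le[OF y(1) h(1) _ B h(2)]) (use s in auto)
  then have "Cf * (1 + 2 * sup_norm h ?w) \<le> Cf * (1 + 2 * (B + K * (S - t)))"
    using \<open>0 < Cf\<close> by simp
  then have C: "Cf * (1 + 2 * sup_norm h ?w) < K" using K by linarith
  \<comment> \<open>The cone has slope \<open>K\<close> and height \<open>S - s\<close>, positive
    since \<open>s < S\<close>, so every extension to a point of it is again an admissible
    path.\<close>
  have touch: "projection h \<phi> s ?w \<xi> x - ?u \<xi> x \<le> projection h \<phi> s ?w s (?w 0) - ?u s (?w 0)"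
    if "(\<xi>, x) \<in> cone s (s + (S - s)) (?w 0) K" for \<xi> x
  proof -
    have \<xi>: "s \<le> \<xi>" "\<xi> \<le> S" "norm (x - y s) \<le> K * (\<xi> - s)" using that by (auto simp: cone_def w0)
    show ?thesis
    proof (cases "\<xi> = s")
      case True
      then show ?thesis using \<xi> by (simp add: w0)
    next
      case False
      then have "s < \<xi>" using \<xi> by simp
      define v where "v = extend y s \<xi> x"
      have v: "v \<in> paths h K t S w"
        unfolding v_def using \<xi> s \<open>s < \<xi>\<close> h by (intro extend_in_paths y) auto
      have "energy t (min \<xi> s') v y' \<le> energy t (min s s') y y'
          + (K * \<bar>s - s'\<bar> + norm (y s - y' s'))\<^sup>2 * (\<xi> - s)"
        by (rule energy_extension_le[OF y v]) (use \<open>s < \<xi>\<close> \<xi> s h in \<open>auto simp: v_def\<close>)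
      also have "\<dots> \<le> energy t (min s s') y y' + \<epsilon> * (\<gamma> / 2) * (\<xi> - s)"
        using small \<xi> by (intro add_left_mono mult_right_mono) auto
      finally have "energy t (min \<xi> s') v y' / \<epsilon> \<le> (energy t (min s s') y y' + \<epsilon> * (\<gamma> / 2) * (\<xi> - s)) / \<epsilon>"
        using \<open>\<epsilon> > 0\<close> by (intro divide_right_mono) auto
      also have "\<dots> = energy t (min s s') y y' / \<epsilon> + \<gamma> / 2 * (\<xi> - s)"
        using \<open>\<epsilon> > 0\<close> by (simp add: add_divide_distrib)
      finally have "penalty \<epsilon> t \<xi> v s' y' - ?u \<xi> x - \<gamma> * \<xi> \<le> penalty \<epsilon> t s y s' y' - ?u s (y s) - \<gamma> * s"
        using \<open>s < \<xi>\<close> by (simp add: penalty_def v_def add_divide_distrib diff_divide_distrib algebra_simps)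
      moreover have "projection h \<phi> s ?w \<xi> x = \<phi> \<xi> (history h v \<xi>)"
        using \<open>s < \<xi>\<close> h by (simp add: projection_def history_polygonal v_def)
      moreover have "projection h \<phi> s ?w s (?w 0) = \<phi> s (history h y s)" by (simp add: projection_def)
      ultimately show ?thesis using max[OF _ v, of \<xi>] \<xi> s by (simp add: w0)
    qed
  qed
  have "\<epsilon> \<noteq> 0" using \<open>\<epsilon> > 0\<close> by simp
  note C1 = C1_with_quadratic[OF this, of s' "y' s'" "\<gamma> / 2"]
  have "\<forall>(\<xi>, x)\<in>cone s (s + (S - s)) (?w 0) K. projection h \<phi> s ?w \<xi> x - ?u \<xi> x \<le> projection h \<phi> s ?w s (?w 0) - ?u s (?w 0)"
    using touch by blast
  moreover have "S - s > 0" "s + (S - s) \<le> T" "s \<in> {t0..<T}" using s h by auto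
  ultimately have "2 * (s - s') / \<epsilon> - \<gamma> / 2 + H s (?w 0) (?w (- \<tau> s (?w 0))) ((2 / \<epsilon>) *\<^sub>R (?w 0 - y' s')) \<ge> 0"
    using sub[unfolded viscosity_subsolution_def, THEN conjunct2, THEN bspec, THEN bspec, OF _ w, THEN spec, THEN spec, THEN spec,
        THEN spec, THEN spec, THEN mp, OF _ conjI[OF C1 conjI[OF C]]] by blast
  then show ?thesis by (simp only: w0)
qed

subsection \<open>Comparison\<close>

text \<open>Young's inequality \<open>x \<le> c / 2 + x\<^sup>2 / (2 * c)\<close>, integrated. The
  weight \<open>c\<close> stays free because it is used with two different values.\<close>

lemma L1_le_energy:
  fixes y :: "real \<Rightarrow> real^'n"
  assumes "y \<in> paths h K t S w" "y' \<in> paths h K t S w" "0 \<le> h" "\<sigma> \<in> {t..S}" "c > 0"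
  shows "integral {t..\<sigma>} (\<lambda>\<eta>. norm (y \<eta> - y' \<eta>)) \<le> c / 2 * (S - t) + energy t \<sigma> y y' / (2 * c)"
proof -
  let ?d = "\<lambda>\<eta>. norm (y \<eta> - y' \<eta>)"
  have cd: "continuous_on {t..\<sigma>} ?d"
    using assms by (intro paths_diff_continuous_on) auto
  have "?d \<eta> \<le> c / 2 + (?d \<eta>)\<^sup>2 / (2 * c)" for \<eta>
  proof -
    have "0 \<le> (?d \<eta> - c)\<^sup>2 / (2 * c)" using \<open>c > 0\<close> by simp
    also have "\<dots> = c / 2 + (?d \<eta>)\<^sup>2 / (2 * c) - ?d \<eta>"
      using \<open>c > 0\<close> by (simp add: power2_diff field_simps power2_eq_square)
    finally show ?thesis by simp
  qed
  then have "integral {t..\<sigma>} ?d \<le> integral {t..\<sigma>} (\<lambda>\<eta>. c / 2 + (?d \<eta>)\<^sup>2 / (2 * c))"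
    using \<open>c > 0\<close> by (intro integral_le integrable_continuous_real continuous_intros cd) auto
  also have "\<dots> = integral {t..\<sigma>} (\<lambda>_. c / 2) + integral {t..\<sigma>} (\<lambda>\<eta>. (?d \<eta>)\<^sup>2 / (2 * c))"
    using \<open>c > 0\<close> by (intro integral_add integrable_continuous_real continuous_intros cd) auto
  also have "integral {t..\<sigma>} (\<lambda>_. c / 2) \<le> c / 2 * (S - t)"
    using assms by (simp add: mult.commute)
  finally show ?thesis by (simp add: energy_def)
qed

lemma energy_nonneg: "0 \<le> energy t \<sigma> y y'"
  unfolding energy_def
  by (cases "(\<lambda>\<eta>. (norm (y \<eta> - y' \<eta>))\<^sup>2) integrable_on {t..\<sigma>}")
    (simp_all add: integral_nonneg not_integrable_integral)

text \<open>The penalty is quadratic over \<open>\<epsilon>\<close> while its bound is linear.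
  Young's inequality absorbs half of the penalty and leaves
  \<open>E\<^sup>2 * \<epsilon> / 2\<close>; collecting the three remainders gives the value of
  \<open>E\<close>.\<close>

lemma penalty_estimates:
  fixes y :: "real \<Rightarrow> real^'n"
  assumes y: "y \<in> paths h K t S w" "y' \<in> paths h K t S w" and s: "s \<in> {t..S}" "s' \<in> {t..S}"
    and "0 \<le> h" "\<epsilon> > 0" "N > 0" and E: "E = N * sqrt (2 + (S - t))"
    and P: "penalty \<epsilon> t s y s' y' \<le> N * (\<bar>s - s'\<bar> + norm (y s - y' s')
      + integral {t..min s s'} (\<lambda>\<eta>. norm (y \<eta> - y' \<eta>)))"
  shows "\<bar>s - s'\<bar> \<le> E * \<epsilon>" "norm (y s - y' s') \<le> E * \<epsilon>"
    "integral {t..min s s'} (\<lambda>\<eta>. norm (y \<eta> - y' \<eta>)) \<le> ((S - t) / 2 + E\<^sup>2 / 2) * \<epsilon>"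
proof -
  define a b I J where "a = \<bar>s - s'\<bar>" and "b = norm (y s - y' s')"
    and "I = integral {t..min s s'} (\<lambda>\<eta>. norm (y \<eta> - y' \<eta>))" and "J = energy t (min s s') y y'"
  have "J \<ge> 0" by (simp add: J_def energy_nonneg)
  have ab: "0 \<le> a" "0 \<le> b" by (simp_all add: a_def b_def)
  have E2: "E\<^sup>2 = N\<^sup>2 * (2 + (S - t))" using s by (simp add: E power_mult_distrib)
  have "E \<ge> 0" using s \<open>N > 0\<close> by (simp add: E)
  have I: "I \<le> c / 2 * (S - t) + J / (2 * c)" if "c > 0" for c
    unfolding I_def J_def by (rule L1_le_energy[OF y \<open>0 \<le> h\<close> _ that]) (use s in auto)
  have amgm: "N * x \<le> N\<^sup>2 * \<epsilon> / 2 + x\<^sup>2 / (2 * \<epsilon>)" for x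
  proof -
    have "0 \<le> (x - N * \<epsilon>)\<^sup>2 / (2 * \<epsilon>)" using \<open>\<epsilon> > 0\<close> by simp
    also have "\<dots> = N\<^sup>2 * \<epsilon> / 2 + x\<^sup>2 / (2 * \<epsilon>) - N * x"
      using \<open>\<epsilon> > 0\<close> by (simp add: power2_diff field_simps power2_eq_square)
    finally show ?thesis by simp
  qed
  \<comment> \<open>The weight \<open>N * \<epsilon>\<close> gives \<open>J\<close> the coefficient
    \<open>1 / (2 * \<epsilon>)\<close>, half of its coefficient in the penalty.\<close>
  have "N * I \<le> N * (N * \<epsilon> / 2 * (S - t) + J / (2 * (N * \<epsilon>)))"
    using I[of "N * \<epsilon>"] \<open>N > 0\<close> \<open>\<epsilon> > 0\<close> by (intro mult_left_mono) auto
  also have "\<dots> = N\<^sup>2 * \<epsilon> / 2 * (S - t) + J / (2 * \<epsilon>)"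
    using \<open>N > 0\<close> by (simp add: distrib_left power2_eq_square)
  finally have NI: "N * I \<le> N\<^sup>2 * \<epsilon> / 2 * (S - t) + J / (2 * \<epsilon>)" .
  have "(a\<^sup>2 + b\<^sup>2 + J) / \<epsilon> \<le> N * a + N * b + N * I"
    using P by (simp add: penalty_def a_def b_def I_def J_def distrib_left)
  also have "\<dots> \<le> E\<^sup>2 * \<epsilon> / 2 + (a\<^sup>2 + b\<^sup>2 + J) / \<epsilon> / 2"
    using amgm[of a] amgm[of b] NI by (simp add: E2 algebra_simps add_divide_distrib diff_divide_distrib)
  finally have "(a\<^sup>2 + b\<^sup>2 + J) / \<epsilon> \<le> E\<^sup>2 * \<epsilon>" by simp
  then have sum: "a\<^sup>2 + b\<^sup>2 + J \<le> (E * \<epsilon>)\<^sup>2"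
    using \<open>\<epsilon> > 0\<close> by (simp add: pos_divide_le_eq power2_eq_square mult.assoc mult.left_commute)
  have "a\<^sup>2 \<le> (E * \<epsilon>)\<^sup>2" "b\<^sup>2 \<le> (E * \<epsilon>)\<^sup>2" "J \<le> (E * \<epsilon>)\<^sup>2"
    using sum \<open>J \<ge> 0\<close> zero_le_power2[of a] zero_le_power2[of b] by linarith+
  then show "\<bar>s - s'\<bar> \<le> E * \<epsilon>" "norm (y s - y' s') \<le> E * \<epsilon>"
    using \<open>E \<ge> 0\<close> \<open>\<epsilon> > 0\<close> unfolding a_def[symmetric] b_def[symmetric] by (auto intro: power2_le_imp_le)
  \<comment> \<open>Now the weight is \<open>\<epsilon>\<close>: with
    \<open>J \<le> (E * \<epsilon>)\<^sup>2\<close> both terms are of order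
    \<open>\<epsilon>\<close>.\<close>
  have "I \<le> \<epsilon> / 2 * (S - t) + (E * \<epsilon>)\<^sup>2 / (2 * \<epsilon>)"
    using I[OF \<open>\<epsilon> > 0\<close>] divide_right_mono[OF \<open>J \<le> _\<close>, of "2 * \<epsilon>"] \<open>\<epsilon> > 0\<close> by simp
  also have "\<dots> = ((S - t) / 2 + E\<^sup>2 / 2) * \<epsilon>"
    using \<open>\<epsilon> > 0\<close> by (simp add: power2_eq_square field_simps)
  finally show "integral {t..min s s'} (\<lambda>\<eta>. norm (y \<eta> - y' \<eta>)) \<le> ((S - t) / 2 + E\<^sup>2 / 2) * \<epsilon>"
    by (simp add: I_def)
qed

lemma constant_extension_in_paths:
  assumes "M-lipschitz_on {-h..0} w" "M \<le> K" "0 \<le> h" "t \<le> S"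
  shows "(\<lambda>\<eta>. if \<eta> \<le> t then w (\<eta> - t) else w 0) \<in> paths h K t S w"
proof -
  have K: "K-lipschitz_on {-h..0} w" using assms(1,2) by (rule lipschitz_on_le)
  have "K-lipschitz_on {t - h..t} (\<lambda>\<eta>. w (\<eta> - t))"
  proof (rule lipschitz_onI)
    fix a b assume "a \<in> {t - h..t}" "b \<in> {t - h..t}"
    then show "dist (w (a - t)) (w (b - t)) \<le> K * dist a b"
      using lipschitz_onD[OF K, of "a - t" "b - t"] by (simp add: dist_norm)
  qed (rule lipschitz_on_nonneg[OF K])
  moreover have "K-lipschitz_on {t..S} (\<lambda>_. w 0)"
    by (rule lipschitz_on_le[OF lipschitz_on_constant]) (rule lipschitz_on_nonneg[OF K])
  ultimately have "K-lipschitz_on {t - h..S} (\<lambda>\<eta>. if \<eta> \<le> t then w (\<eta> - t) else w 0)"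
    by (rule lipschitz_on_concat) simp
  then show ?thesis by (simp add: paths_def)
qed

text \<open>A larger slope \<open>K\<close> allows larger paths, which demand larger cone constants,
  which \<open>K\<close> must exceed. The smallness of \<open>Cf * (S - t)\<close> breaks this
  circle.\<close>

lemma comparison_short_time:
  fixes \<tau> :: "real \<Rightarrow> real^'n \<Rightarrow> real" and H :: "real \<Rightarrow> real^'n \<Rightarrow> real^'n \<Rightarrow> real^'n \<Rightarrow> real"
  assumes sub: "viscosity_subsolution t0 T h \<tau> Cf H \<psi>1"
    and super: "viscosity_supersolution t0 T h \<tau> Cf H \<psi>2"
    and "0 < Cf" and \<tau>_cont: "continuous_on ({t0..T} \<times> UNIV) (\<lambda>(t, z). \<tau> t z)"
    and \<tau>: "\<And>t z. t \<in> {t0..T} \<Longrightarrow> 0 \<le> \<tau> t z \<and> \<tau> t z \<le> h"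
    and H: "\<And>B e. e > 0 \<Longrightarrow> \<exists>d>0. \<forall>s s' z z' y y' p. s \<in> {t0..T} \<and> s' \<in> {t0..T} \<and>
      norm z \<le> B \<and> norm z' \<le> B \<and> norm y \<le> B \<and> norm y' \<le> B \<and> norm p \<le> B \<and>
      \<bar>s - s'\<bar> < d \<and> norm (z - z') < d \<and> norm (y - y') < d \<longrightarrow> H s z y p - H s' z' y' p \<le> e"
    and t: "t0 \<le> t" "t < S" "S \<le> T" "Cf * (S - t) \<le> 1 / 4"
    and le: "\<And>w. w \<in> Lip h \<Longrightarrow> \<psi>1 S w \<le> \<psi>2 S w" and w: "w \<in> Lip h"
  shows "\<psi>1 t w \<le> \<psi>2 t w"
proof (rule ccontr)
  assume "\<not> ?thesis"
  define m where "m = \<psi>1 t w - \<psi>2 t w"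
  have "m > 0" using \<open>\<not> _\<close> by (simp add: m_def)
  have Phi: "\<psi>1 \<in> class_Phi t0 T h" "\<psi>2 \<in> class_Phi t0 T h"
    using sub super by (simp_all add: viscosity_subsolution_def viscosity_supersolution_def)
  have "0 \<le> h" using \<tau>[of t 0] t by force
  obtain M0 where M0: "M0-lipschitz_on {-h..0} w" using w by (auto simp: Lip_def)
  have "bounded (w ` {-h..0})"
    by (intro compact_imp_bounded compact_continuous_image lipschitz_on_continuous_on[OF M0]) simp
  then obtain B where B: "\<forall>\<theta>\<in>{-h..0}. norm (w \<theta>) \<le> B" unfolding bounded_iff by blast
  have "B \<ge> 0" using bspec[OF B, of 0] \<open>0 \<le> h\<close> norm_ge_zero[of "w 0"] by (simp del: norm_ge_zero)
  \<comment> \<open>\<open>M0\<close> makes the constant extension of \<open>w\<close> admissible.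
    By the second entry, less than half of \<open>K\<close> covers \<open>Cf * (1 + 2 * B)\<close>,
    and the other half covers \<open>2 * Cf * K * (S - t)\<close>.\<close>
  define K where "K = max M0 (2 * (Cf * (1 + 2 * B)) + 1)"
  have K: "M0 \<le> K" "2 * (Cf * (1 + 2 * B)) + 1 \<le> K" by (simp_all add: K_def)
  have "0 \<le> Cf * (1 + 2 * B)" using \<open>0 < Cf\<close> \<open>B \<ge> 0\<close> by simp
  then have "K > 0" using K by linarith
  define R where "R = B + K * (S - t)"
  have "Cf * (S - t) * K \<le> 1 / 4 * K" using t(4) \<open>K > 0\<close> by (intro mult_right_mono) auto
  then have CK: "Cf * (1 + 2 * R) < K" using K by (simp add: R_def algebra_simps)
  let ?P = "paths h K t S w"
  define y0 where "y0 = (\<lambda>\<eta>. if \<eta> \<le> t then w (\<eta> - t) else w 0)"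
  have y0: "y0 \<in> ?P"
    unfolding y0_def using M0 K(1) \<open>0 \<le> h\<close> t by (intro constant_extension_in_paths) auto
  have hist0: "history h y0 t = w"
  proof
    show "history h y0 t \<theta> = w \<theta>" for \<theta>
      using w by (auto simp: history_def y0_def Lip_def extensional_def)
  qed
  note hyps = \<open>0 \<le> h\<close> less_imp_le[OF \<open>K > 0\<close>] t(1) less_imp_le[OF t(2)] t(3)
  obtain M1 where M1: "M1 > 0" "\<forall>y\<in>?P. \<forall>y'\<in>?P. \<forall>s\<in>{t..S}. \<forall>s'\<in>{t..S}. \<bar>\<psi>1 s (history h y s) - \<psi>1 s' (history h y' s')\<bar>
      \<le> M1 * (\<bar>s - s'\<bar> + norm (y s - y' s') + integral {t..min s s'} (\<lambda>\<eta>. norm (y \<eta> - y' \<eta>)))"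
    using Phi_paths_lipschitz[OF Phi(1) hyps B] by blast
  obtain M2 where M2: "M2 > 0" "\<forall>y\<in>?P. \<forall>y'\<in>?P. \<forall>s\<in>{t..S}. \<forall>s'\<in>{t..S}. \<bar>\<psi>2 s (history h y s) - \<psi>2 s' (history h y' s')\<bar>
      \<le> M2 * (\<bar>s - s'\<bar> + norm (y s - y' s') + integral {t..min s s'} (\<lambda>\<eta>. norm (y \<eta> - y' \<eta>)))"
    using Phi_paths_lipschitz[OF Phi(2) hyps B] by blast
  \<comment> \<open>Chosen so that the reward for late times uses up at most half of the gap
    \<open>m\<close>.\<close>
  define \<gamma> where "\<gamma> = m / (4 * (S - t))"
  have "\<gamma> > 0" using \<open>m > 0\<close> t by (simp add: \<gamma>_def)
  have \<gamma>m: "2 * \<gamma> * (S - t) = m / 2" using t by (simp add: \<gamma>_def field_simps)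
  define N where "N = M1 + \<gamma>"
  have "N > 0" using M1 \<open>\<gamma> > 0\<close> by (simp add: N_def)
  define E where "E = N * sqrt (2 + (S - t))"
  have "E \<ge> 0" using \<open>N > 0\<close> t by (simp add: E_def)
  define G where "G = (S - t) / 2 + E\<^sup>2 / 2"
  have "\<gamma> / 2 > 0" using \<open>\<gamma> > 0\<close> by simp
  \<comment> \<open>\<open>R\<close> bounds all values of the paths and \<open>2 * E\<close> will
    bound the test gradient, both independently of \<open>\<epsilon>\<close>, so \<open>d\<close>
    can be fixed before \<open>\<epsilon>\<close>.\<close>
  from H[OF this, of "max R (2 * E)"] obtain d where "d > 0" and
    d: "\<And>s s' z z' y y' p. s \<in> {t0..T} \<Longrightarrow> s' \<in> {t0..T} \<Longrightarrow>
      norm z \<le> R \<Longrightarrow> norm z' \<le> R \<Longrightarrow> norm y \<le> R \<Longrightarrow> norm y' \<le> R \<Longrightarrow> norm p \<le> 2 * E \<Longrightarrow>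
      \<bar>s - s'\<bar> < d \<Longrightarrow> norm (z - z') < d \<Longrightarrow> norm (y - y') < d \<Longrightarrow> H s z y p - H s' z' y' p \<le> \<gamma> / 2"
    by (metis max.coboundedI1 max.coboundedI2)
  \<comment> \<open>A change of the delay by \<open>\<rho>\<close> moves a delayed value by at most
    \<open>d / 2\<close>.\<close>
  define \<rho> where "\<rho> = d / (2 * K)"
  have "\<rho> > 0" using \<open>d > 0\<close> \<open>K > 0\<close> by (simp add: \<rho>_def)
  have "uniformly_continuous_on ({t0..T} \<times> cball 0 R) (\<lambda>(t, z). \<tau> t z)"
    by (intro compact_uniformly_continuous continuous_on_subset[OF \<tau>_cont] compact_Times) auto
  then obtain d' where "d' > 0" and d': "\<And>q q'. q \<in> {t0..T} \<times> cball 0 R \<Longrightarrow> q' \<in> {t0..T} \<times> cball 0 R \<Longrightarrow>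
      dist q' q < d' \<Longrightarrow> dist ((\<lambda>(t, z). \<tau> t z) q') ((\<lambda>(t, z). \<tau> t z) q) < \<rho>"
    using \<open>\<rho> > 0\<close> unfolding uniformly_continuous_on_def by meson
  \<comment> \<open>After positivity, the smallness conditions serve in this order: excluding the
    terminal time, absorbing the energy growth, closeness of times and states, closeness of the
    delays, and closeness of the delayed values.\<close>
  have "\<forall>\<^sub>F \<epsilon> in at_right 0. \<epsilon> > (0::real)" by (simp add: eventually_at_right_less)
  moreover have "\<forall>\<^sub>F \<epsilon> in at_right 0. (M1 + M2) * (2 * E + G) * \<epsilon> < m / 2"
    by (rule order_tendstoD(2)[where y = 0]) (use \<open>m > 0\<close> in \<open>auto intro!: tendsto_eq_intros\<close>)
  moreover have "\<forall>\<^sub>F \<epsilon> in at_right 0. ((K + 1) * E)\<^sup>2 * \<epsilon> < \<gamma> / 2"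
    by (rule order_tendstoD(2)[where y = 0]) (use \<open>\<gamma> > 0\<close> in \<open>auto intro!: tendsto_eq_intros\<close>)
  moreover have "\<forall>\<^sub>F \<epsilon> in at_right 0. E * \<epsilon> < d"
    by (rule order_tendstoD(2)[where y = 0]) (use \<open>d > 0\<close> in \<open>auto intro!: tendsto_eq_intros\<close>)
  moreover have "\<forall>\<^sub>F \<epsilon> in at_right 0. 2 * E * \<epsilon> < d'"
    by (rule order_tendstoD(2)[where y = 0]) (use \<open>d' > 0\<close> in \<open>auto intro!: tendsto_eq_intros\<close>)
  moreover have "\<forall>\<^sub>F \<epsilon> in at_right 0. 3 * K * E * \<epsilon> + sqrt (8 * K * G * \<epsilon>) < d / 2"
    by (rule order_tendstoD(2)[where y = 0]) (use \<open>d > 0\<close> in \<open>auto intro!: tendsto_eq_intros\<close>)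
  ultimately have "\<forall>\<^sub>F \<epsilon> in at_right 0. \<epsilon> > 0 \<and> (M1 + M2) * (2 * E + G) * \<epsilon> < m / 2 \<and> ((K + 1) * E)\<^sup>2 * \<epsilon> < \<gamma> / 2
      \<and> E * \<epsilon> < d \<and> 2 * E * \<epsilon> < d' \<and> 3 * K * E * \<epsilon> + sqrt (8 * K * G * \<epsilon>) < d / 2"
    by (intro eventually_conj)
  from eventually_happens[OF this] obtain \<epsilon> :: real where "\<epsilon> > 0"
    and \<epsilon>: "(M1 + M2) * (2 * E + G) * \<epsilon> < m / 2" "((K + 1) * E)\<^sup>2 * \<epsilon> < \<gamma> / 2" "E * \<epsilon> < d"
      "2 * E * \<epsilon> < d'" "3 * K * E * \<epsilon> + sqrt (8 * K * G * \<epsilon>) < d / 2"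
    by auto
  have "?P \<noteq> {}" using y0 by blast
  obtain s y s' y' where sy: "s \<in> {t..S}" "y \<in> ?P" "s' \<in> {t..S}" "y' \<in> ?P"
    and max: "\<forall>r\<in>{t..S}. \<forall>v\<in>?P. \<forall>r'\<in>{t..S}. \<forall>v'\<in>?P.
      \<psi>1 r (history h v r) - \<psi>2 r' (history h v' r') - penalty \<epsilon> t r v r' v' + \<gamma> * (r + r')
      \<le> \<psi>1 s (history h y s) - \<psi>2 s' (history h y' s') - penalty \<epsilon> t s y s' y' + \<gamma> * (s + s')"
    by (rule penalized_maximum_exists[OF Phi hyps B \<open>?P \<noteq> {}\<close> \<open>\<epsilon> > 0\<close>, of \<gamma>])
  note s = sy(1,3) and y = sy(2,4) and max = max[rule_format]
  define a b I where "a = \<bar>s - s'\<bar>" and "b = norm (y s - y' s')"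
    and "I = integral {t..min s s'} (\<lambda>\<eta>. norm (y \<eta> - y' \<eta>))"
  have \<psi>1: "\<bar>\<psi>1 s (history h y s) - \<psi>1 s' (history h y' s')\<bar> \<le> M1 * (a + b + I)"
    using M1(2) s y unfolding a_def b_def I_def by blast
  have \<psi>2: "\<bar>\<psi>2 s (history h y s) - \<psi>2 s' (history h y' s')\<bar> \<le> M2 * (a + b + I)"
    using M2(2) s y unfolding a_def b_def I_def by blast
  have "I \<ge> 0" unfolding I_def
    using s y \<open>0 \<le> h\<close> by (intro integral_nonneg integrable_continuous_real paths_diff_continuous_on) auto
  have ab: "0 \<le> a" "0 \<le> b" by (simp_all add: a_def b_def)
  \<comment> \<open>The competitor puts \<open>(s', y')\<close> in both slots: its penalty is 0 and
    the terms with \<open>\<psi>2\<close> cancel, so only \<open>M1\<close> and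
    \<open>\<gamma>\<close> enter \<open>N\<close>.\<close>
  have "penalty \<epsilon> t s y s' y' \<le> M1 * (a + b + I) + \<gamma> * (s - s')"
    using max[OF s(2) y(2) s(2) y(2)] \<psi>1 by (simp add: algebra_simps)
  also have "\<gamma> * (s - s') \<le> \<gamma> * (a + b + I)"
    using \<open>\<gamma> > 0\<close> ab \<open>I \<ge> 0\<close> by (intro mult_left_mono) (auto simp: a_def)
  finally have "penalty \<epsilon> t s y s' y' \<le> N * (a + b + I)" by (simp add: N_def algebra_simps)
  then have "a \<le> E * \<epsilon>" "b \<le> E * \<epsilon>" "I \<le> G * \<epsilon>"
    using penalty_estimates[OF y s \<open>0 \<le> h\<close> \<open>\<epsilon> > 0\<close> \<open>N > 0\<close> E_def] unfolding a_def b_def I_def G_def by blast+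
  note est = this
  have "(M1 + M2) * (a + b + I) \<le> (M1 + M2) * ((2 * E + G) * \<epsilon>)"
    using est M1 M2 by (intro mult_left_mono) (auto simp: algebra_simps)
  then have small: "M1 * (a + b + I) + M2 * (a + b + I) < m / 2" using \<epsilon>(1) by (simp add: algebra_simps)
  have nonneg: "0 \<le> M1 * (a + b + I)" "0 \<le> M2 * (a + b + I)"
    using M1 M2 ab \<open>I \<ge> 0\<close> by simp_all
  have "0 \<le> penalty \<epsilon> t s y s' y'"
    using \<open>\<epsilon> > 0\<close> by (simp add: penalty_def energy_nonneg)
  moreover have "\<gamma> * (s + s') \<le> \<gamma> * (2 * S)" using s \<open>\<gamma> > 0\<close> by (intro mult_left_mono) auto
  \<comment> \<open>The competitor is the constant extension at time \<open>t\<close> in both slots;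
    its history there is \<open>w\<close>, so it realises the gap \<open>m\<close>.\<close>
  moreover have "m + \<gamma> * (t + t) \<le> \<psi>1 s (history h y s) - \<psi>2 s' (history h y' s')
      - penalty \<epsilon> t s y s' y' + \<gamma> * (s + s')"
    using max[OF _ y0 _ y0, of t t] t by (simp add: hist0 m_def)
  moreover have "\<gamma> * (2 * S) - \<gamma> * (t + t) = m / 2" using \<gamma>m by (simp add: algebra_simps)
  ultimately have big: "m / 2 \<le> \<psi>1 s (history h y s) - \<psi>2 s' (history h y' s')"
    by linarith
  \<comment> \<open>At time \<open>S\<close> the terminal inequality holds for a common history;
    passing to the other time and path costs less than \<open>m / 2\<close>, against
    \<open>big\<close>.\<close>
  have "s \<noteq> S"
  proof
    assume "s = S"
    then have "\<psi>1 s (history h y s) \<le> \<psi>2 s (history h y s)"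
      using le[OF history_in_Lip[OF paths_lipschitz_history[OF y(1) s(1)]]] by simp
    then show False using big \<psi>2 small nonneg by linarith
  qed
  moreover have "s' \<noteq> S"
  proof
    assume "s' = S"
    then have "\<psi>1 s' (history h y' s') \<le> \<psi>2 s' (history h y' s')"
      using le[OF history_in_Lip[OF paths_lipschitz_history[OF y(2) s(2)]]] by simp
    then show False using big \<psi>1 small nonneg by linarith
  qed
  ultimately have sS: "s \<in> {t..<S}" "s' \<in> {t..<S}" using s by auto
  have s0: "s \<in> {t0..T}" "s' \<in> {t0..T}" using s t by auto
  have inc: "(K * a + b)\<^sup>2 \<le> \<epsilon> * (\<gamma> / 2)"
  proof -
    have "K * a + b \<le> K * (E * \<epsilon>) + E * \<epsilon>"
      using est \<open>K > 0\<close> by (intro add_mono mult_left_mono) auto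
    then have "(K * a + b)\<^sup>2 \<le> ((K + 1) * E * \<epsilon>)\<^sup>2"
      using ab \<open>K > 0\<close> by (intro power_mono) (auto simp: algebra_simps)
    also have "\<dots> = \<epsilon> * (((K + 1) * E)\<^sup>2 * \<epsilon>)" by (simp add: power2_eq_square)
    also have "\<dots> \<le> \<epsilon> * (\<gamma> / 2)" using \<epsilon>(2) \<open>\<epsilon> > 0\<close> by (intro mult_left_mono) auto
    finally show ?thesis .
  qed
  let ?yd = "y (s - \<tau> s (y s))" and ?yd' = "y' (s' - \<tau> s' (y' s'))"
  let ?p = "(2 / \<epsilon>) *\<^sub>R (y s - y' s')"
  have 1: "0 \<le> 2 * (s - s') / \<epsilon> - \<gamma> / 2 + H s (y s) ?yd ?p"
  proof (rule subsolution_at_penalized_maximum[OF sub hyps(1,2,3,5) \<open>0 < Cf\<close> B _ _ _ y sS(1) s(2) \<open>\<epsilon> > 0\<close>])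
    show "Cf * (1 + 2 * (B + K * (S - t))) < K" using CK by (simp add: R_def)
    show "(K * \<bar>s - s'\<bar> + norm (y s - y' s'))\<^sup>2 \<le> \<epsilon> * (\<gamma> / 2)" using inc by (simp add: a_def b_def)
    show "\<psi>1 \<xi> (history h v \<xi>) - penalty \<epsilon> t \<xi> v s' y' + \<gamma> * \<xi> \<le> \<psi>1 s (history h y s) - penalty \<epsilon> t s y s' y' + \<gamma> * s"
      if "\<xi> \<in> {t..S}" "v \<in> ?P" for \<xi> v
      using max[OF that s(2) y(2)] by (simp add: algebra_simps)
  qed (use \<tau> s0 in auto)
  \<comment> \<open>Negating \<open>\<psi>2\<close> and using the symmetry of the penalty, the same
    lemma applies with the roles of the two points exchanged.\<close>
  have 2: "0 \<le> 2 * (s' - s) / \<epsilon> - \<gamma> / 2 + - H s' (y' s') ?yd' (- ((2 / \<epsilon>) *\<^sub>R (y' s' - y s)))"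
  proof (rule subsolution_at_penalized_maximum[OF supersolution_uminus[OF super] hyps(1,2,3,5) \<open>0 < Cf\<close> B _ _ _ y(2,1) sS(2) s(1) \<open>\<epsilon> > 0\<close>])
    show "Cf * (1 + 2 * (B + K * (S - t))) < K" using CK by (simp add: R_def)
    show "(K * \<bar>s' - s\<bar> + norm (y' s' - y s))\<^sup>2 \<le> \<epsilon> * (\<gamma> / 2)"
      using inc by (simp add: a_def b_def norm_minus_commute abs_minus_commute)
    show "- \<psi>2 \<xi> (history h v \<xi>) - penalty \<epsilon> t \<xi> v s y + \<gamma> * \<xi> \<le> - \<psi>2 s' (history h y' s') - penalty \<epsilon> t s' y' s y + \<gamma> * s'"
      if "\<xi> \<in> {t..S}" "v \<in> ?P" for \<xi> v
      using max[OF s(1) y(1) that] by (simp add: algebra_simps penalty_commute[of \<epsilon> t s y])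
  qed (use \<tau> s0 in auto)
  \<comment> \<open>Both inequalities carry the same gradient. In their sum the quotients by
    \<open>\<epsilon>\<close> cancel and the two halves of \<open>\<gamma>\<close> add up.\<close>
  have "- ((2 / \<epsilon>) *\<^sub>R (y' s' - y s)) = ?p" by (simp add: algebra_simps)
  then have "\<gamma> \<le> H s (y s) ?yd ?p - H s' (y' s') ?yd' ?p"
    using 1 2 by (simp add: diff_divide_distrib algebra_simps)
  moreover have "H s (y s) ?yd ?p - H s' (y' s') ?yd' ?p \<le> \<gamma> / 2"
  proof (rule d[OF s0])
    have bd: "norm (v \<eta>) \<le> R" if "v \<in> ?P" "\<eta> \<in> {t - h..S}" for v \<eta>
      unfolding R_def by (rule paths_norm_le[OF that(1) \<open>0 \<le> h\<close> that(2) B]) (use \<open>K > 0\<close> t in auto)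
    have del: "s - \<tau> s (y s) \<in> {t - h..s}" "s' - \<tau> s' (y' s') \<in> {t - h..s'}"
      using \<tau>[OF s0(1), of "y s"] \<tau>[OF s0(2), of "y' s'"] s by auto
    show n: "norm (y s) \<le> R" "norm (y' s') \<le> R" using s \<open>0 \<le> h\<close> y by (auto intro!: bd)
    show "norm ?yd \<le> R" "norm ?yd' \<le> R" using s del y by (auto intro!: bd)
    have "norm ?p = 2 / \<epsilon> * b" using \<open>\<epsilon> > 0\<close> by (simp add: b_def)
    also have "\<dots> \<le> 2 / \<epsilon> * (E * \<epsilon>)" using est \<open>\<epsilon> > 0\<close> by (intro mult_left_mono) auto
    finally show "norm ?p \<le> 2 * E" using \<open>\<epsilon> > 0\<close> by simp
    show "\<bar>s - s'\<bar> < d" "norm (y s - y' s') < d"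
      using est \<epsilon>(3) by (simp_all add: a_def b_def)
    have "dist (s, y s) (s', y' s') \<le> a + b"
      unfolding a_def b_def dist_norm using norm_Pair_le[of "s - s'" "y s - y' s'"] by simp
    then have "dist (s, y s) (s', y' s') < d'" using est \<epsilon>(4) by simp
    then have "\<bar>\<tau> s (y s) - \<tau> s' (y' s')\<bar> < \<rho>"
      using d'[of "(s', y' s')" "(s, y s)"] s0 n by (simp add: dist_real_def)
    then have diff: "\<bar>(s - \<tau> s (y s)) - (s' - \<tau> s' (y' s'))\<bar> \<le> E * \<epsilon> + \<rho>"
      using est unfolding a_def by linarith
    have "norm (?yd - ?yd') \<le> K * (2 * \<bar>s - s'\<bar> + \<bar>(s - \<tau> s (y s)) - (s' - \<tau> s' (y' s'))\<bar>) + sqrt (8 * K * I)"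
      unfolding I_def by (rule paths_delayed_diff_le[OF y s del \<open>0 \<le> h\<close> hyps(2)])
    also have "\<dots> \<le> K * (2 * (E * \<epsilon>) + (E * \<epsilon> + \<rho>)) + sqrt (8 * K * (G * \<epsilon>))"
      using diff est \<open>K > 0\<close> by (intro add_mono mult_left_mono real_sqrt_le_mono) (auto simp: a_def)
    also have "\<dots> = 3 * K * E * \<epsilon> + sqrt (8 * K * G * \<epsilon>) + K * \<rho>" by (simp add: algebra_simps)
    also have "K * \<rho> = d / 2" using \<open>K > 0\<close> by (simp add: \<rho>_def)
    finally show "norm (?yd - ?yd') < d" using \<epsilon>(5) by simp
  qed
  ultimately show False using \<open>\<gamma> > 0\<close> by simp
qed

text \<open>The admissible length of a short interval depends on \<open>Cf\<close> alone, not on the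
  history, so finitely many backward steps from \<open>T\<close> reach every time.\<close>

lemma comparison:
  fixes \<tau> :: "real \<Rightarrow> real^'n \<Rightarrow> real" and H :: "real \<Rightarrow> real^'n \<Rightarrow> real^'n \<Rightarrow> real^'n \<Rightarrow> real"
  assumes sub: "viscosity_subsolution t0 T h \<tau> Cf H \<psi>1"
    and super: "viscosity_supersolution t0 T h \<tau> Cf H \<psi>2"
    and "0 < Cf" and \<tau>_cont: "continuous_on ({t0..T} \<times> UNIV) (\<lambda>(t, z). \<tau> t z)"
    and \<tau>: "\<And>t z. t \<in> {t0..T} \<Longrightarrow> 0 \<le> \<tau> t z \<and> \<tau> t z \<le> h"
    and H: "\<And>B e. e > 0 \<Longrightarrow> \<exists>d>0. \<forall>s s' z z' y y' p. s \<in> {t0..T} \<and> s' \<in> {t0..T} \<and>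
      norm z \<le> B \<and> norm z' \<le> B \<and> norm y \<le> B \<and> norm y' \<le> B \<and> norm p \<le> B \<and>
      \<bar>s - s'\<bar> < d \<and> norm (z - z') < d \<and> norm (y - y') < d \<longrightarrow> H s z y p - H s' z' y' p \<le> e"
    and le: "\<forall>w\<in>Lip h. \<psi>1 T w \<le> \<psi>2 T w" and t: "t \<in> {t0..T}" and w: "w \<in> Lip h"
  shows "\<psi>1 t w \<le> \<psi>2 t w"
proof -
  define \<delta> where "\<delta> = 1 / (4 * Cf)"
  have "\<delta> > 0" using \<open>0 < Cf\<close> by (simp add: \<delta>_def)
  \<comment> \<open>Induction on the number of steps, for all histories at once, since the terminal
    inequality of a short interval must hold on all of \<open>Lip h\<close>.\<close>
  have step: "\<psi>1 t w \<le> \<psi>2 t w" if "t \<in> {t0..T}" "T - real n * \<delta> \<le> t" "w \<in> Lip h" for n t w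
    using that
  proof (induction n arbitrary: t w)
    case 0
    then show ?case using le by simp
  next
    case (Suc n)
    define S where "S = min T (t + \<delta>)"
    show ?case
    proof (cases "t = T")
      case True
      then show ?thesis using le Suc.prems by simp
    next
      case False
      show ?thesis
      proof (rule comparison_short_time[OF sub super \<open>0 < Cf\<close> \<tau>_cont \<tau> H])
        show "t0 \<le> t" "t < S" "S \<le> T" using Suc.prems False \<open>\<delta> > 0\<close> by (auto simp: S_def)
        have "Cf * (S - t) \<le> Cf * \<delta>" using \<open>0 < Cf\<close> by (intro mult_left_mono) (auto simp: S_def)
        then show "Cf * (S - t) \<le> 1 / 4" using \<open>0 < Cf\<close> by (simp add: \<delta>_def)
        have "T - real n * \<delta> \<le> S" using Suc.prems(2) \<open>\<delta> > 0\<close> by (auto simp: S_def algebra_simps)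
        then show "\<psi>1 S w \<le> \<psi>2 S w" if "w \<in> Lip h" for w
          using that Suc.prems(1) \<open>\<delta> > 0\<close> by (intro Suc.IH) (auto simp: S_def)
      qed (use Suc.prems in auto)
    qed
  qed
  obtain n where "(T - t0) / \<delta> \<le> real n" using real_arch_simple by blast
  then have "T - real n * \<delta> \<le> t" using \<open>\<delta> > 0\<close> t by (simp add: pos_divide_le_eq)
  then show ?thesis using step t w by blast
qed

theorem theorem4p6:
  fixes t0 T h Cf :: real
    and A :: "(real^'m) set"
    and f :: "real \<Rightarrow> real^'n \<Rightarrow> real^'n \<Rightarrow> real^'m \<Rightarrow> real^'n"
    and L :: "real \<Rightarrow> real^'n \<Rightarrow> real^'n \<Rightarrow> real^'m \<Rightarrow> real"
    and g :: "(real^'n) \<times> (real \<Rightarrow> real^'n) \<Rightarrow> real"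
    and \<tau> \<tau>t :: "real \<Rightarrow> real^'n \<Rightarrow> real"
    and \<tau>z :: "real \<Rightarrow> real^'n \<Rightarrow> real^'n"
  assumes "t0 < T"
    and "A \<noteq> {}" and "convex A" and "compact A"
    and f_cont: "continuous_on ({t0..T} \<times> UNIV \<times> UNIV \<times> A) (\<lambda>(t, z, y, a). f t z y a)"
    and L_cont: "continuous_on ({t0..T} \<times> UNIV \<times> UNIV \<times> A) (\<lambda>(t, z, y, a). L t z y a)"
    and f_lipschitz: "\<exists>l>0. \<forall>t\<in>{t0..T}. \<forall>z y z' y'. \<forall>a\<in>A.
      norm (f t z y a - f t z' y' a) \<le> l * (norm (z - z') + norm (y - y'))"
    and "Cf > 0"
    and f_growth: "\<forall>t\<in>{t0..T}. \<forall>z y. \<forall>a\<in>A.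
      norm (f t z y a) \<le> Cf * (1 + norm z + norm y)"
    and epigraph_convex: "\<forall>t\<in>{t0..T}. \<forall>z y.
      convex {(f t z y a, l) | a l. a \<in> A \<and> l \<ge> L t z y a}"
    and L_lipschitz: "\<forall>R>0. \<exists>l>0. \<forall>t\<in>{t0..T}. \<forall>a\<in>A.
      \<forall>z\<in>cball 0 R. \<forall>y\<in>cball 0 R. \<forall>z'\<in>cball 0 R. \<forall>y'\<in>cball 0 R.
        \<bar>L t z y a - L t z' y' a\<bar> \<le> l * (norm (z - z') + norm (y - y'))"
    and L_growth: "\<exists>CL>0. \<forall>t\<in>{t0..T}. \<forall>z y. \<forall>a\<in>A.
      \<bar>L t z y a\<bar> \<le> CL * (1 + norm z + norm y)"
    and g_lipschitz: "\<forall>R>0. \<exists>l>0. \<forall>(z1, w1)\<in>X_space h. \<forall>(z2, w2)\<in>X_space h.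
      w1 \<in> P_ball h R \<and> w2 \<in> P_ball h R \<longrightarrow>
        \<bar>g (z1, w1) - g (z2, w2)\<bar> \<le> l * X_norm h (z1 - z2, \<lambda>\<theta>. w1 \<theta> - w2 \<theta>)"
    and \<tau>_nonneg: "\<forall>t\<in>{t0..T}. \<forall>z. \<tau> t z \<ge> 0"
    and \<tau>_C1: "C1_with {t0..T} \<tau> \<tau>t \<tau>z"
    and \<tau>_bdd: "bdd_above ((\<lambda>(t, z). \<tau> t z) ` ({t0..T} \<times> UNIV))"
    and \<tau>_sup: "h = (SUP (t, z)\<in>{t0..T} \<times> UNIV. \<tau> t z)"
    and \<tau>_lipschitz: "\<exists>l>0. \<forall>t\<in>{t0..T}. \<forall>z y. \<bar>\<tau> t z - \<tau> t y\<bar> \<le> l * norm (z - y)"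
    and monotone_delay: "\<forall>r>0. \<exists>d>0. \<forall>t\<in>{t0..T}. \<forall>w\<in>P_ball h r. \<forall>\<alpha>\<in>controls A t T. \<forall>x.
      delay_solution T h \<tau> f t w \<alpha> x \<longrightarrow>
        (AE s in lebesgue_on {t..T}.
           1 - \<tau>t s (x s) - \<tau>z s (x s) \<bullet> vector_derivative x (at s) \<ge> d)"
  shows "(\<forall>\<psi>1\<in>class_Phi t0 T h. \<forall>\<psi>2\<in>class_Phi t0 T h.
            viscosity_subsolution t0 T h \<tau> Cf (Hamiltonian A f L) \<psi>1 \<and>
            viscosity_supersolution t0 T h \<tau> Cf (Hamiltonian A f L) \<psi>2 \<and>
            (\<forall>w\<in>Lip h. \<psi>1 T w \<le> \<psi>2 T w) \<longrightarrow>
              (\<forall>t\<in>{t0..T}. \<forall>w\<in>Lip h. \<psi>1 t w \<le> \<psi>2 t w)) \<and>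
         (\<forall>\<psi>1 \<psi>2.
            viscosity_solution t0 T h \<tau> Cf (Hamiltonian A f L) g \<psi>1 \<and>
            viscosity_solution t0 T h \<tau> Cf (Hamiltonian A f L) g \<psi>2 \<longrightarrow>
              (\<forall>t\<in>{t0..T}. \<forall>w\<in>Lip h. \<psi>1 t w = \<psi>2 t w))"
proof -
  have \<tau>_le: "\<tau> t z \<le> h" if "t \<in> {t0..T}" for t z
    unfolding \<tau>_sup using cSUP_upper[OF _ \<tau>_bdd, of "(t, z)"] that by simp
  have \<tau>: "0 \<le> \<tau> t z \<and> \<tau> t z \<le> h" if "t \<in> {t0..T}" for t z
    using \<tau>_nonneg \<tau>_le that by blast
  have \<tau>_cont: "continuous_on ({t0..T} \<times> UNIV) (\<lambda>(t, z). \<tau> t z)"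
    unfolding continuous_on_eq_continuous_within
    using \<tau>_C1 by (auto simp: C1_with_def intro: has_derivative_continuous)
  have H: "\<exists>d>0. \<forall>s s' z z' y y' p. s \<in> {t0..T} \<and> s' \<in> {t0..T} \<and>
      norm z \<le> B \<and> norm z' \<le> B \<and> norm y \<le> B \<and> norm y' \<le> B \<and> norm p \<le> B \<and>
      \<bar>s - s'\<bar> < d \<and> norm (z - z') < d \<and> norm (y - y') < d \<longrightarrow>
      Hamiltonian A f L s z y p - Hamiltonian A f L s' z' y' p \<le> e" if "e > 0" for B e
    by (rule Hamiltonian_uniformly_continuous[OF \<open>A \<noteq> {}\<close> \<open>compact A\<close> f_cont L_cont that, of B]) blast
  have cmp: "\<psi>1 t w \<le> \<psi>2 t w"
    if "viscosity_subsolution t0 T h \<tau> Cf (Hamiltonian A f L) \<psi>1"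
      "viscosity_supersolution t0 T h \<tau> Cf (Hamiltonian A f L) \<psi>2"
      "\<forall>w\<in>Lip h. \<psi>1 T w \<le> \<psi>2 T w" "t \<in> {t0..T}" "w \<in> Lip h" for \<psi>1 \<psi>2 t w
    by (rule comparison[OF that(1,2) \<open>Cf > 0\<close> \<tau>_cont \<tau> H that(3-5)])
  show ?thesis
  proof (intro conjI allI ballI impI)
    fix \<psi>1 \<psi>2 :: "real \<Rightarrow> (real \<Rightarrow> real^'n) \<Rightarrow> real" and t and w :: "real \<Rightarrow> real^'n"
    assume "viscosity_subsolution t0 T h \<tau> Cf (Hamiltonian A f L) \<psi>1 \<and>
      viscosity_supersolution t0 T h \<tau> Cf (Hamiltonian A f L) \<psi>2 \<and> (\<forall>w\<in>Lip h. \<psi>1 T w \<le> \<psi>2 T w)"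
      "t \<in> {t0..T}" "w \<in> Lip h"
    then show "\<psi>1 t w \<le> \<psi>2 t w" using cmp by blast
  next
    fix \<psi>1 \<psi>2 :: "real \<Rightarrow> (real \<Rightarrow> real^'n) \<Rightarrow> real" and t and w :: "real \<Rightarrow> real^'n"
    assume v: "viscosity_solution t0 T h \<tau> Cf (Hamiltonian A f L) g \<psi>1 \<and>
      viscosity_solution t0 T h \<tau> Cf (Hamiltonian A f L) g \<psi>2" and tw: "t \<in> {t0..T}" "w \<in> Lip h"
    \<comment> \<open>Both solutions equal \<open>g\<close> at \<open>T\<close>, so comparison
      applies in either direction.\<close>
    then have "\<forall>w\<in>Lip h. \<psi>1 T w \<le> \<psi>2 T w" "\<forall>w\<in>Lip h. \<psi>2 T w \<le> \<psi>1 T w"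
      by (simp_all add: viscosity_solution_def)
    then show "\<psi>1 t w = \<psi>2 t w"
      using v tw unfolding viscosity_solution_def by (intro antisym cmp) auto
  qed
qed

end
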